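(* Let $R$ be a ring and $M$ a right $R$-module. (i) $M$ is a Baer $R$-module if and only if every exact sequence $0\rightarrow X\rightarrow M\rightarrow Y\rightarrow 0$ of $R$-modules with $Y\in \mathrm{Cog}(M)$ splits. (ii) $M$ is a dual Baer $R$-module if and only if every exact sequence $0\rightarrow X\rightarrow M\rightarrow Y\rightarrow 0$ of $R$-modules with $X\in \mathrm{Gen}(M)$ splits.
   Context: Rings have a unit element and modules are right unitary modules; endomorphisms act on the left. Let $S=\mathrm{End}_R(M)$. $M$ is Baer if for every non-empty subset $X\subseteq S$ the annihilator $r_M(X)=\{m\in M: f(m)=0 \text{ for all } f\in X\}=\bigcap_{f\in X}\ker f$ is a direct summand of $M$. $M$ is dual Baer if for every submodule $N\leq M$ the right ideal $\mathrm{Hom}_R(M,N)=\{f\in S: f(M)\subseteq N\}$ of $S$ is generated by an idempotent, i.e. equals $eS$ for some $e=e^2\in S$. $\mathrm{Cog}(M)$ is the class of $R$-modules cogenerated by $M$ (those embeddable in a direct product $M^{\Lambda}$ for some set $\Lambda$), and $\mathrm{Gen}(M)$ is the class of $R$-modules generated by $M$ (homomorphic images of direct sums $M^{(\Lambda)}$). *)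

theory Defs
  imports "HOL-Algebra.Module" "HOL-Algebra.AbelCoset"
begin

section \<open>Right modules over a unital, not necessarily commutative ring\<close>

text \<open>
  The library locale for modules presupposes a commutative ring, so only its record type
  (and the locale \<open>submodule\<close>, which does not need commutativity) is reused here.
  Scalars act from the right: \<open>a \<odot>\<^bsub>M\<^esub> x\<close> stands for \<open>x \<cdot> a\<close>.  Accordingly the
  associativity axiom below is \<open>x \<cdot> (a b) = (x \<cdot> a) \<cdot> b\<close>.
\<close>

locale right_module = R?: ring R + M?: abelian_group M
  for R :: "('r, 'q) ring_scheme" (structure)
    and M :: "('r, 'm, 'z) module_scheme" (structure) +
  assumes rsmult_closed [simp, intro]:
      "\<lbrakk>a \<in> carrier R; x \<in> carrier M\<rbrakk> \<Longrightarrow> a \<odot>\<^bsub>M\<^esub> x \<in> carrier M"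
    and rsmult_ring_distr:
      "\<lbrakk>a \<in> carrier R; b \<in> carrier R; x \<in> carrier M\<rbrakk>
        \<Longrightarrow> (a \<oplus>\<^bsub>R\<^esub> b) \<odot>\<^bsub>M\<^esub> x = a \<odot>\<^bsub>M\<^esub> x \<oplus>\<^bsub>M\<^esub> b \<odot>\<^bsub>M\<^esub> x"
    and rsmult_add_distr:
      "\<lbrakk>a \<in> carrier R; x \<in> carrier M; y \<in> carrier M\<rbrakk>
        \<Longrightarrow> a \<odot>\<^bsub>M\<^esub> (x \<oplus>\<^bsub>M\<^esub> y) = a \<odot>\<^bsub>M\<^esub> x \<oplus>\<^bsub>M\<^esub> a \<odot>\<^bsub>M\<^esub> y"
    and rsmult_assoc:
      "\<lbrakk>a \<in> carrier R; b \<in> carrier R; x \<in> carrier M\<rbrakk>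
        \<Longrightarrow> (a \<otimes>\<^bsub>R\<^esub> b) \<odot>\<^bsub>M\<^esub> x = b \<odot>\<^bsub>M\<^esub> (a \<odot>\<^bsub>M\<^esub> x)"
    and rsmult_one [simp]: "x \<in> carrier M \<Longrightarrow> \<one>\<^bsub>R\<^esub> \<odot>\<^bsub>M\<^esub> x = x"

definition rmod_hom ::
  "('r, 'q) ring_scheme \<Rightarrow> ('r, 'm, 'z) module_scheme \<Rightarrow> ('r, 'n, 'w) module_scheme \<Rightarrow> ('m \<Rightarrow> 'n) set"
  where "rmod_hom R M N =
    {f \<in> hom (add_monoid M) (add_monoid N).
       \<forall>a\<in>carrier R. \<forall>x\<in>carrier M. f (a \<odot>\<^bsub>M\<^esub> x) = a \<odot>\<^bsub>N\<^esub> f x}"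

text \<open>
  Endomorphisms are normalised to be \<open>undefined\<close> off the carrier, so that two of them are
  equal as functions iff they agree on \<open>M\<close>.  They act on the left: the product is
  \<open>(f g)(x) = f (g x)\<close>.
\<close>

definition End :: "('r, 'q) ring_scheme \<Rightarrow> ('r, 'm, 'z) module_scheme \<Rightarrow> ('m \<Rightarrow> 'm) ring"
  where "End R M =
    \<lparr>carrier = rmod_hom R M M \<inter> extensional (carrier M),
     monoid.mult = compose (carrier M),
     one = (\<lambda>x\<in>carrier M. x),
     ring.zero = (\<lambda>x\<in>carrier M. \<zero>\<^bsub>M\<^esub>),
     ring.add = (\<lambda>f g. \<lambda>x\<in>carrier M. f x \<oplus>\<^bsub>M\<^esub> g x)\<rparr>"

definition direct_summand ::
  "'m set \<Rightarrow> ('r, 'q) ring_scheme \<Rightarrow> ('r, 'm, 'z) module_scheme \<Rightarrow> bool"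
  where "direct_summand N R M \<longleftrightarrow> submodule N R M \<and>
    (\<exists>K. submodule K R M \<and> N <+>\<^bsub>M\<^esub> K = carrier M \<and> N \<inter> K = {\<zero>\<^bsub>M\<^esub>})"


section \<open>Baer and dual Baer modules\<close>

definition right_annihilator :: "('r, 'm, 'z) module_scheme \<Rightarrow> ('m \<Rightarrow> 'm) set \<Rightarrow> 'm set"
  where "right_annihilator M X = {m \<in> carrier M. \<forall>f\<in>X. f m = \<zero>\<^bsub>M\<^esub>}"

definition baer_module :: "('r, 'q) ring_scheme \<Rightarrow> ('r, 'm, 'z) module_scheme \<Rightarrow> bool"
  where "baer_module R M \<longleftrightarrow>
    (\<forall>X. X \<noteq> {} \<and> X \<subseteq> carrier (End R M) \<longrightarrow> direct_summand (right_annihilator M X) R M)"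

definition Hom_into ::
  "('r, 'q) ring_scheme \<Rightarrow> ('r, 'm, 'z) module_scheme \<Rightarrow> 'm set \<Rightarrow> ('m \<Rightarrow> 'm) set"
  where "Hom_into R M N = {f \<in> carrier (End R M). f ` carrier M \<subseteq> N}"

text \<open>\<open>e <#\<^bsub>S\<^esub> carrier S\<close> is the principal right ideal \<open>e S\<close>.\<close>

definition dual_baer_module :: "('r, 'q) ring_scheme \<Rightarrow> ('r, 'm, 'z) module_scheme \<Rightarrow> bool"
  where "dual_baer_module R M \<longleftrightarrow>
    (\<forall>N. submodule N R M \<longrightarrow>
      (\<exists>e\<in>carrier (End R M). e \<otimes>\<^bsub>End R M\<^esub> e = e \<and>
         Hom_into R M N = e <#\<^bsub>End R M\<^esub> carrier (End R M)))"


section \<open>Modules cogenerated and generated by a module\<close>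

text \<open>The direct product \<open>M\<^sup>\<Lambda>\<close> and the direct sum \<open>M\<^sup>(\<^sup>\<Lambda>\<^sup>)\<close>.  The multiplicative
  fields of the record play no role for modules.\<close>

definition module_power :: "('r, 'm, 'z) module_scheme \<Rightarrow> 'l set \<Rightarrow> ('r, 'l \<Rightarrow> 'm) module"
  where "module_power M \<Lambda> =
    \<lparr>carrier = (\<Pi>\<^sub>E l\<in>\<Lambda>. carrier M),
     monoid.mult = undefined,
     one = undefined,
     ring.zero = (\<lambda>l\<in>\<Lambda>. \<zero>\<^bsub>M\<^esub>),
     ring.add = (\<lambda>u v. \<lambda>l\<in>\<Lambda>. u l \<oplus>\<^bsub>M\<^esub> v l),
     smult = (\<lambda>a u. \<lambda>l\<in>\<Lambda>. a \<odot>\<^bsub>M\<^esub> u l)\<rparr>"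

definition module_copower :: "('r, 'm, 'z) module_scheme \<Rightarrow> 'l set \<Rightarrow> ('r, 'l \<Rightarrow> 'm) module"
  where "module_copower M \<Lambda> = (module_power M \<Lambda>)
    \<lparr>carrier := {u \<in> carrier (module_power M \<Lambda>). finite {l \<in> \<Lambda>. u l \<noteq> \<zero>\<^bsub>M\<^esub>}}\<rparr>"

text \<open>
  A type cannot be quantified existentially, so the index set \<open>\<Lambda>\<close> is taken in the type of
  functions \<open>Y \<rightarrow> M\<close> (resp. \<open>M \<rightarrow> Y\<close>).  This loses nothing: \<open>Cog_any_index\<close> and
  \<open>Gen_any_index\<close> below show that index sets of any other type yield the same modules.
\<close>

definition Cog ::
  "('r, 'q) ring_scheme \<Rightarrow> ('r, 'm, 'z) module_scheme \<Rightarrow> ('r, 'y, 'w) module_scheme set"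
  where "Cog R M = {Y. right_module R Y \<and>
    (\<exists>(\<Lambda> :: ('y \<Rightarrow> 'm) set) i. i \<in> rmod_hom R Y (module_power M \<Lambda>) \<and> inj_on i (carrier Y))}"

definition Gen ::
  "('r, 'q) ring_scheme \<Rightarrow> ('r, 'm, 'z) module_scheme \<Rightarrow> ('r, 'y, 'w) module_scheme set"
  where "Gen R M = {Y. right_module R Y \<and>
    (\<exists>(\<Lambda> :: ('m \<Rightarrow> 'y) set) p. p \<in> rmod_hom R (module_copower M \<Lambda>) Y \<and>
       p ` carrier (module_copower M \<Lambda>) = carrier Y)}"


section \<open>Short exact sequences\<close>

definition short_exact ::
  "('r, 'q) ring_scheme \<Rightarrow> ('r, 'x, 'u) module_scheme \<Rightarrow> ('r, 'm, 'v) module_scheme \<Rightarrow>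
   ('r, 'y, 'w) module_scheme \<Rightarrow> ('x \<Rightarrow> 'm) \<Rightarrow> ('m \<Rightarrow> 'y) \<Rightarrow> bool"
  where "short_exact R X M Y f g \<longleftrightarrow>
    right_module R X \<and> right_module R M \<and> right_module R Y \<and>
    f \<in> rmod_hom R X M \<and> g \<in> rmod_hom R M Y \<and>
    inj_on f (carrier X) \<and> f ` carrier X = a_kernel M Y g \<and> g ` carrier M = carrier Y"

text \<open>A short exact sequence with epimorphism \<open>g\<close> from \<open>M\<close> onto \<open>Y\<close> splits if \<open>g\<close> has a section.\<close>

definition splits ::
  "('r, 'q) ring_scheme \<Rightarrow> ('r, 'm, 'v) module_scheme \<Rightarrow> ('r, 'y, 'w) module_scheme \<Rightarrow>
   ('m \<Rightarrow> 'y) \<Rightarrow> bool"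
  where "splits R M Y g \<longleftrightarrow> (\<exists>s \<in> rmod_hom R Y M. \<forall>y\<in>carrier Y. g (s y) = y)"


section \<open>Independence of the type of index sets\<close>

lemma rmod_homI:
  assumes "\<And>x. x \<in> carrier M \<Longrightarrow> f x \<in> carrier N"
    and "\<And>x y. \<lbrakk>x \<in> carrier M; y \<in> carrier M\<rbrakk> \<Longrightarrow> f (x \<oplus>\<^bsub>M\<^esub> y) = f x \<oplus>\<^bsub>N\<^esub> f y"
    and "\<And>a x. \<lbrakk>a \<in> carrier R; x \<in> carrier M\<rbrakk> \<Longrightarrow> f (a \<odot>\<^bsub>M\<^esub> x) = a \<odot>\<^bsub>N\<^esub> f x"
  shows "f \<in> rmod_hom R M N"
  using assms by (auto simp: rmod_hom_def hom_def)

lemma rmod_homD: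
  assumes "f \<in> rmod_hom R M N"
  shows "x \<in> carrier M \<Longrightarrow> f x \<in> carrier N"
    and "\<lbrakk>x \<in> carrier M; y \<in> carrier M\<rbrakk> \<Longrightarrow> f (x \<oplus>\<^bsub>M\<^esub> y) = f x \<oplus>\<^bsub>N\<^esub> f y"
    and "\<lbrakk>a \<in> carrier R; x \<in> carrier M\<rbrakk> \<Longrightarrow> f (a \<odot>\<^bsub>M\<^esub> x) = a \<odot>\<^bsub>N\<^esub> f x"
  using assms by (auto simp: rmod_hom_def hom_def)

lemma (in right_module) rsmult_zero [simp]:
  assumes "a \<in> carrier R" shows "a \<odot>\<^bsub>M\<^esub> \<zero>\<^bsub>M\<^esub> = \<zero>\<^bsub>M\<^esub>"
proof -
  have "a \<odot>\<^bsub>M\<^esub> \<zero>\<^bsub>M\<^esub> \<oplus>\<^bsub>M\<^esub> a \<odot>\<^bsub>M\<^esub> \<zero>\<^bsub>M\<^esub> = a \<odot>\<^bsub>M\<^esub> \<zero>\<^bsub>M\<^esub>"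
    using rsmult_add_distr[OF assms, of "\<zero>\<^bsub>M\<^esub>" "\<zero>\<^bsub>M\<^esub>"] by simp
  then show ?thesis
    using assms M.add.l_cancel_one by blast
qed

lemma Cog_any_index:
  fixes \<Lambda> :: "'l set"
  assumes Y: "right_module R Y" and M: "right_module R M"
    and i: "i \<in> rmod_hom R Y (module_power M \<Lambda>)" and inj: "inj_on i (carrier Y)"
  shows "Y \<in> Cog R M"
proof -
  interpret Y: right_module R Y by fact
  define h where "h = (\<lambda>l. \<lambda>y\<in>carrier Y. i y l)"
  define j where "j = (\<lambda>y. \<lambda>k\<in>h ` \<Lambda>. k y)"
  have c: "i y \<in> (\<Pi>\<^sub>E l\<in>\<Lambda>. carrier M)" if "y \<in> carrier Y" for y
    using rmod_homD(1)[OF i that] by (simp add: module_power_def)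
  have "j \<in> rmod_hom R Y (module_power M (h ` \<Lambda>))"
  proof (rule rmod_homI)
    show "j x \<in> carrier (module_power M (h ` \<Lambda>))" if "x \<in> carrier Y" for x
      using c[OF that] that by (auto simp: module_power_def j_def h_def)
    show "j (x \<oplus>\<^bsub>Y\<^esub> y) = j x \<oplus>\<^bsub>module_power M (h ` \<Lambda>)\<^esub> j y"
      if "x \<in> carrier Y" "y \<in> carrier Y" for x y
      using that rmod_homD(2)[OF i that]
      by (auto simp: module_power_def j_def h_def intro!: restrict_ext)
    show "j (a \<odot>\<^bsub>Y\<^esub> x) = a \<odot>\<^bsub>module_power M (h ` \<Lambda>)\<^esub> j x"
      if "a \<in> carrier R" "x \<in> carrier Y" for a x
      using that rmod_homD(3)[OF i that]
      by (auto simp: module_power_def j_def h_def intro!: restrict_ext)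
  qed
  moreover have "inj_on j (carrier Y)"
  proof (rule inj_onI)
    fix x y assume xy: "x \<in> carrier Y" "y \<in> carrier Y" and eq: "j x = j y"
    have "i x l = i y l" if "l \<in> \<Lambda>" for l
      using fun_cong[OF eq, of "h l"] that xy by (simp add: j_def) (simp add: h_def)
    then have "i x = i y"
      using PiE_ext[OF c[OF xy(1)] c[OF xy(2)]] by blast
    then show "x = y"
      using inj xy by (auto dest: inj_onD)
  qed
  ultimately show ?thesis
    using Y unfolding Cog_def by blast
qed

lemma Gen_any_index:
  fixes \<Lambda> :: "'l set"
  assumes Y: "right_module R Y" and M: "right_module R M"
    and p: "p \<in> rmod_hom R (module_copower M \<Lambda>) Y"
    and surj: "p ` carrier (module_copower M \<Lambda>) = carrier Y"
  shows "Y \<in> Gen R M"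
proof -
  interpret Y: right_module R Y by fact
  interpret M: right_module R M by fact
  note defs = module_copower_def module_power_def
  define sg where "sg = (\<lambda>l m. \<lambda>k\<in>\<Lambda>. if k = l then m else \<zero>\<^bsub>M\<^esub>)"
  define h where "h = (\<lambda>l. \<lambda>m\<in>carrier M. p (sg l m))"
  define s where "s = inv_into \<Lambda> h"
  have s: "s k \<in> \<Lambda>" "h (s k) = k" if "k \<in> h ` \<Lambda>" for k
    using that by (auto simp: s_def inv_into_into f_inv_into_f)
  define E where "E = (\<lambda>u. \<lambda>l\<in>\<Lambda>. if s (h l) = l then u (h l) else \<zero>\<^bsub>M\<^esub>)"
  let ?C = "module_copower M \<Lambda>" and ?D = "module_copower M (h ` \<Lambda>)"
  have E: "E \<in> rmod_hom R ?D ?C"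
  proof (rule rmod_homI)
    fix u assume u: "u \<in> carrier ?D"
    have "{l \<in> \<Lambda>. E u l \<noteq> \<zero>\<^bsub>M\<^esub>} \<subseteq> s ` {k \<in> h ` \<Lambda>. u k \<noteq> \<zero>\<^bsub>M\<^esub>}"
    proof
      fix l assume "l \<in> {l \<in> \<Lambda>. E u l \<noteq> \<zero>\<^bsub>M\<^esub>}"
      then have l: "l \<in> \<Lambda>" "s (h l) = l" "u (h l) \<noteq> \<zero>\<^bsub>M\<^esub>"
        by (auto simp: E_def split: if_splits)
      then have "h l \<in> {k \<in> h ` \<Lambda>. u k \<noteq> \<zero>\<^bsub>M\<^esub>}" by blast
      then show "l \<in> s ` {k \<in> h ` \<Lambda>. u k \<noteq> \<zero>\<^bsub>M\<^esub>}"
        by (rule image_eqI[where f = s, OF l(2)[symmetric]])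
    qed
    moreover have "finite {k \<in> h ` \<Lambda>. u k \<noteq> \<zero>\<^bsub>M\<^esub>}"
      using u by (simp add: defs)
    ultimately have "finite {l \<in> \<Lambda>. E u l \<noteq> \<zero>\<^bsub>M\<^esub>}"
      by (meson finite_imageI finite_subset)
    moreover have "E u \<in> (\<Pi>\<^sub>E l\<in>\<Lambda>. carrier M)"
      using u by (auto simp: defs E_def)
    ultimately show "E u \<in> carrier ?C" by (simp add: defs)
  next
    fix u v assume "u \<in> carrier ?D" "v \<in> carrier ?D"
    then show "E (u \<oplus>\<^bsub>?D\<^esub> v) = E u \<oplus>\<^bsub>?C\<^esub> E v"
      by (auto simp: defs E_def intro!: restrict_ext)
  next
    fix a u assume "a \<in> carrier R" "u \<in> carrier ?D"
    then show "E (a \<odot>\<^bsub>?D\<^esub> u) = a \<odot>\<^bsub>?C\<^esub> E u"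
      by (auto simp: defs E_def intro!: restrict_ext)
  qed
  define q where "q = (\<lambda>u. p (E u))"
  have q: "q \<in> rmod_hom R ?D Y"
  proof (rule rmod_homI)
    show "q u \<in> carrier Y" if "u \<in> carrier ?D" for u
      using that by (simp add: q_def rmod_homD(1)[OF p] rmod_homD(1)[OF E])
    show "q (u \<oplus>\<^bsub>?D\<^esub> v) = q u \<oplus>\<^bsub>Y\<^esub> q v" if "u \<in> carrier ?D" "v \<in> carrier ?D" for u v
      using that by (simp add: q_def rmod_homD[OF p] rmod_homD[OF E])
    show "q (a \<odot>\<^bsub>?D\<^esub> u) = a \<odot>\<^bsub>Y\<^esub> q u" if "a \<in> carrier R" "u \<in> carrier ?D" for a u
      using that by (simp add: q_def rmod_homD[OF p] rmod_homD[OF E])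
  qed
  have Dadd: "u \<oplus>\<^bsub>?D\<^esub> v \<in> carrier ?D" if u: "u \<in> carrier ?D" and v: "v \<in> carrier ?D" for u v
  proof -
    have "{l \<in> h ` \<Lambda>. u l \<oplus>\<^bsub>M\<^esub> v l \<noteq> \<zero>\<^bsub>M\<^esub>}
        \<subseteq> {l \<in> h ` \<Lambda>. u l \<noteq> \<zero>\<^bsub>M\<^esub>} \<union> {l \<in> h ` \<Lambda>. v l \<noteq> \<zero>\<^bsub>M\<^esub>}"
      by auto
    moreover have "finite ({l \<in> h ` \<Lambda>. u l \<noteq> \<zero>\<^bsub>M\<^esub>} \<union> {l \<in> h ` \<Lambda>. v l \<noteq> \<zero>\<^bsub>M\<^esub>})"
      using u v by (simp add: defs)
    ultimately have "finite {l \<in> h ` \<Lambda>. u l \<oplus>\<^bsub>M\<^esub> v l \<noteq> \<zero>\<^bsub>M\<^esub>}"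
      by (rule finite_subset)
    moreover have "{l \<in> h ` \<Lambda>. (u \<oplus>\<^bsub>?D\<^esub> v) l \<noteq> \<zero>\<^bsub>M\<^esub>} = {l \<in> h ` \<Lambda>. u l \<oplus>\<^bsub>M\<^esub> v l \<noteq> \<zero>\<^bsub>M\<^esub>}"
      by (auto simp: defs)
    ultimately have "finite {l \<in> h ` \<Lambda>. (u \<oplus>\<^bsub>?D\<^esub> v) l \<noteq> \<zero>\<^bsub>M\<^esub>}" by simp
    moreover have "u \<oplus>\<^bsub>?D\<^esub> v \<in> (\<Pi>\<^sub>E l\<in>h ` \<Lambda>. carrier M)"
      using u v by (auto simp: defs)
    ultimately show ?thesis by (simp add: defs)
  qed
  have qadd: "x \<oplus>\<^bsub>Y\<^esub> y \<in> q ` carrier ?D" if "x \<in> q ` carrier ?D" "y \<in> q ` carrier ?D" for x y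
  proof -
    from that obtain u v where uv: "u \<in> carrier ?D" "v \<in> carrier ?D" "x = q u" "y = q v"
      by blast
    have "x \<oplus>\<^bsub>Y\<^esub> y = q (u \<oplus>\<^bsub>?D\<^esub> v)"
      unfolding uv(3,4) by (rule rmod_homD(2)[OF q uv(1,2), symmetric])
    then show ?thesis by (rule image_eqI[OF _ Dadd[OF uv(1,2)]])
  qed
  have sgC: "sg l m \<in> carrier ?C" if "l \<in> \<Lambda>" "m \<in> carrier M" for l m
  proof -
    have "{k \<in> \<Lambda>. sg l m k \<noteq> \<zero>\<^bsub>M\<^esub>} \<subseteq> {l}" by (auto simp: sg_def)
    then have "finite {k \<in> \<Lambda>. sg l m k \<noteq> \<zero>\<^bsub>M\<^esub>}" using finite_subset by blast
    then show ?thesis using that by (auto simp: defs sg_def)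
  qed
  have psg: "p (sg l m) \<in> q ` carrier ?D" if l: "l \<in> \<Lambda>" and m: "m \<in> carrier M" for l m
  proof -
    define w where "w = (\<lambda>k\<in>h ` \<Lambda>. if k = h l then m else \<zero>\<^bsub>M\<^esub>)"
    have "{k \<in> h ` \<Lambda>. w k \<noteq> \<zero>\<^bsub>M\<^esub>} \<subseteq> {h l}" by (auto simp: w_def)
    then have "finite {k \<in> h ` \<Lambda>. w k \<noteq> \<zero>\<^bsub>M\<^esub>}" using finite_subset by blast
    then have w: "w \<in> carrier ?D" using m by (auto simp: defs w_def)
    have hl: "h l \<in> h ` \<Lambda>" using l by blast
    have "E w = sg (s (h l)) m"
      unfolding E_def sg_def
    proof (rule restrict_ext)
      fix k assume k: "k \<in> \<Lambda>"
      have "s (h k) = k \<and> h k = h l \<longleftrightarrow> k = s (h l)"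
        using s(2)[OF hl] by auto
      then show "(if s (h k) = k then w (h k) else \<zero>\<^bsub>M\<^esub>) = (if k = s (h l) then m else \<zero>\<^bsub>M\<^esub>)"
        using k hl by (auto simp: w_def)
    qed
    moreover have "p (sg (s (h l)) m) = p (sg l m)"
      using fun_cong[OF s(2)[OF hl], of m] m by (simp add: h_def)
    ultimately have "q w = p (sg l m)" by (simp add: q_def)
    then show ?thesis using image_eqI[OF _ w, of _ q] by (simp only:)
  qed
  have zero: "p (\<lambda>k\<in>\<Lambda>. \<zero>\<^bsub>M\<^esub>) \<in> q ` carrier ?D"
  proof -
    have "(\<lambda>k\<in>h ` \<Lambda>. \<zero>\<^bsub>M\<^esub>) \<in> carrier ?D" by (auto simp: defs)
    moreover have "E (\<lambda>k\<in>h ` \<Lambda>. \<zero>\<^bsub>M\<^esub>) = (\<lambda>k\<in>\<Lambda>. \<zero>\<^bsub>M\<^esub>)"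
      unfolding E_def by (rule restrict_ext) auto
    ultimately show ?thesis using image_eqI[of _ q "\<lambda>k\<in>h ` \<Lambda>. \<zero>\<^bsub>M\<^esub>" "carrier ?D"]
      by (simp only: q_def)
  qed
  have main: "p u \<in> q ` carrier ?D"
    if "finite F" "u \<in> carrier ?C" "{l \<in> \<Lambda>. u l \<noteq> \<zero>\<^bsub>M\<^esub>} \<subseteq> F" for F u
    using that
  proof (induction F arbitrary: u rule: finite_induct)
    case empty
    have "u = (\<lambda>k\<in>\<Lambda>. \<zero>\<^bsub>M\<^esub>)"
    proof
      fix k show "u k = (\<lambda>k\<in>\<Lambda>. \<zero>\<^bsub>M\<^esub>) k"
        using empty by (cases "k \<in> \<Lambda>") (auto simp: defs PiE_def extensional_def)
    qed
    then show ?case using zero by (simp only:)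
  next
    case (insert l F)
    have uP: "u \<in> (\<Pi>\<^sub>E l\<in>\<Lambda>. carrier M)" and uf: "finite {l \<in> \<Lambda>. u l \<noteq> \<zero>\<^bsub>M\<^esub>}"
      using insert.prems(1) by (auto simp: defs)
    show ?case
    proof (cases "l \<in> \<Lambda>")
      case False
      then show ?thesis using insert.IH[OF insert.prems(1)] insert.prems(2) by blast
    next
      case True
      define v where "v = (\<lambda>k\<in>\<Lambda>. if k = l then \<zero>\<^bsub>M\<^esub> else u k)"
      have "{k \<in> \<Lambda>. v k \<noteq> \<zero>\<^bsub>M\<^esub>} \<subseteq> {l \<in> \<Lambda>. u l \<noteq> \<zero>\<^bsub>M\<^esub>}" by (auto simp: v_def)
      then have "finite {k \<in> \<Lambda>. v k \<noteq> \<zero>\<^bsub>M\<^esub>}" using uf finite_subset by blast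
      then have v: "v \<in> carrier ?C" using uP by (auto simp: defs v_def)
      have vF: "{k \<in> \<Lambda>. v k \<noteq> \<zero>\<^bsub>M\<^esub>} \<subseteq> F" using insert.prems(2) by (auto simp: v_def)
      have ul: "u l \<in> carrier M" using uP True by auto
      have "u = sg l (u l) \<oplus>\<^bsub>?C\<^esub> v"
      proof
        fix k show "u k = (sg l (u l) \<oplus>\<^bsub>?C\<^esub> v) k"
          using ul PiE_mem[OF uP, of k] PiE_arb[OF uP, of k]
          by (cases "k \<in> \<Lambda>") (simp_all add: defs sg_def v_def)
      qed
      then have "p u = p (sg l (u l)) \<oplus>\<^bsub>Y\<^esub> p v"
        using rmod_homD(2)[OF p sgC[OF True ul] v] by simp
      then show ?thesis
        using qadd[OF psg[OF True ul] insert.IH[OF v vF]] by simp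
    qed
  qed
  have "carrier Y \<subseteq> q ` carrier ?D"
  proof
    fix y assume "y \<in> carrier Y"
    then obtain u where u: "u \<in> carrier ?C" "y = p u" using surj by blast
    moreover have "finite {l \<in> \<Lambda>. u l \<noteq> \<zero>\<^bsub>M\<^esub>}" using u(1) by (simp add: defs)
    ultimately show "y \<in> q ` carrier ?D" using main by blast
  qed
  moreover have "q ` carrier ?D \<subseteq> carrier Y" using rmod_homD(1)[OF q] by blast
  ultimately show ?thesis
    using Y q unfolding Gen_def by blast
qed

end

theory Submission
  imports Defs
begin

text \<open>
  For an epimorphism \<open>g\<close> from \<open>M\<close> onto \<open>Y\<close> with kernel \<open>N\<close>, three things are equivalent: \<open>g\<close>
  has a section, there is an endomorphism of \<open>M\<close> mapping into \<open>N\<close> and fixing \<open>N\<close> pointwise,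
  and \<open>N\<close> is a direct summand.

  (i) If \<open>Y\<close> embeds into \<open>M\<^sup>\<Lambda>\<close>, then \<open>ker g\<close> is the annihilator of the endomorphisms obtained by
  composing \<open>g\<close> with the coordinates of the embedding; conversely, the elements of \<open>X\<close> are the
  coordinates of an embedding of \<open>M / r\<^sub>M(X)\<close> into \<open>M\<^sup>X\<close>.

  (ii) If \<open>N = ker g\<close> is generated by \<open>M\<close> and \<open>Hom(M, N) = e S\<close>, then \<open>N\<close> is a sum of images of
  elements of \<open>e S\<close>, so \<open>N = e M\<close>. Conversely, the trace \<open>T\<close> of \<open>M\<close> in a submodule \<open>N\<close> is
  generated by \<open>M\<close> and satisfies \<open>Hom(M, N) = Hom(M, T)\<close>; an idempotent \<open>e\<close> with image \<open>T\<close>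
  generates this right ideal.
\<close>

section \<open>Submodules and homomorphisms\<close>

context right_module
begin

lemma zero_rsmult [simp]:
  assumes "x \<in> carrier M" shows "\<zero>\<^bsub>R\<^esub> \<odot>\<^bsub>M\<^esub> x = \<zero>\<^bsub>M\<^esub>"
proof -
  have "\<zero>\<^bsub>R\<^esub> \<odot>\<^bsub>M\<^esub> x \<oplus>\<^bsub>M\<^esub> \<zero>\<^bsub>R\<^esub> \<odot>\<^bsub>M\<^esub> x = \<zero>\<^bsub>R\<^esub> \<odot>\<^bsub>M\<^esub> x"
    using rsmult_ring_distr[of "\<zero>\<^bsub>R\<^esub>" "\<zero>\<^bsub>R\<^esub>" x] assms by simp
  then show ?thesis
    using assms M.add.l_cancel_one by blast
qed

lemma rsmult_minus_one:
  assumes x: "x \<in> carrier M" shows "(\<ominus>\<^bsub>R\<^esub> \<one>\<^bsub>R\<^esub>) \<odot>\<^bsub>M\<^esub> x = \<ominus>\<^bsub>M\<^esub> x"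
proof -
  have "(\<ominus>\<^bsub>R\<^esub> \<one>\<^bsub>R\<^esub>) \<odot>\<^bsub>M\<^esub> x \<oplus>\<^bsub>M\<^esub> x = (\<ominus>\<^bsub>R\<^esub> \<one>\<^bsub>R\<^esub> \<oplus>\<^bsub>R\<^esub> \<one>\<^bsub>R\<^esub>) \<odot>\<^bsub>M\<^esub> x"
    using x by (subst rsmult_ring_distr) auto
  also have "\<dots> = \<zero>\<^bsub>M\<^esub>"
    using x by (simp add: R.l_neg)
  finally show ?thesis
    using x M.minus_equality[of "(\<ominus>\<^bsub>R\<^esub> \<one>\<^bsub>R\<^esub>) \<odot>\<^bsub>M\<^esub> x" x] by simp
qed

lemma rsmult_minus:
  assumes a: "a \<in> carrier R" and x: "x \<in> carrier M"
  shows "a \<odot>\<^bsub>M\<^esub> (\<ominus>\<^bsub>M\<^esub> x) = \<ominus>\<^bsub>M\<^esub> (a \<odot>\<^bsub>M\<^esub> x)"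
proof -
  have "a \<odot>\<^bsub>M\<^esub> (\<ominus>\<^bsub>M\<^esub> x) \<oplus>\<^bsub>M\<^esub> a \<odot>\<^bsub>M\<^esub> x = a \<odot>\<^bsub>M\<^esub> (\<ominus>\<^bsub>M\<^esub> x \<oplus>\<^bsub>M\<^esub> x)"
    using a x by (subst rsmult_add_distr) auto
  also have "\<dots> = \<zero>\<^bsub>M\<^esub>"
    using a x by (simp add: M.l_neg)
  finally show ?thesis
    using a x M.minus_equality[of "a \<odot>\<^bsub>M\<^esub> (\<ominus>\<^bsub>M\<^esub> x)" "a \<odot>\<^bsub>M\<^esub> x"] by simp
qed

text \<open>Closure under negation comes for free: the additive inverse of \<open>x\<close> is
  \<open>x\<close> acted on by minus one.\<close>

lemma submoduleI:
  assumes sub: "N \<subseteq> carrier M" and zero: "\<zero>\<^bsub>M\<^esub> \<in> N"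
    and add: "\<And>x y. \<lbrakk>x \<in> N; y \<in> N\<rbrakk> \<Longrightarrow> x \<oplus>\<^bsub>M\<^esub> y \<in> N"
    and smult: "\<And>a x. \<lbrakk>a \<in> carrier R; x \<in> N\<rbrakk> \<Longrightarrow> a \<odot>\<^bsub>M\<^esub> x \<in> N"
  shows "submodule N R M"
proof
  fix x assume x: "x \<in> N"
  have "\<ominus>\<^bsub>M\<^esub> x \<in> N"
    using smult[OF _ x, of "\<ominus>\<^bsub>R\<^esub> \<one>\<^bsub>R\<^esub>"] sub x rsmult_minus_one by auto
  then show "inv\<^bsub>add_monoid M\<^esub> x \<in> N"
    by (simp add: a_inv_def)
qed (use assms in auto)

end

lemma submoduleD:
  assumes "submodule N R M"
  shows "x \<in> N \<Longrightarrow> x \<in> carrier M"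
    and "\<zero>\<^bsub>M\<^esub> \<in> N"
    and "\<lbrakk>x \<in> N; y \<in> N\<rbrakk> \<Longrightarrow> x \<oplus>\<^bsub>M\<^esub> y \<in> N"
    and "\<lbrakk>a \<in> carrier R; x \<in> N\<rbrakk> \<Longrightarrow> a \<odot>\<^bsub>M\<^esub> x \<in> N"
    and "x \<in> N \<Longrightarrow> \<ominus>\<^bsub>M\<^esub> x \<in> N"
proof -
  interpret submodule N R M by fact
  show "x \<in> N \<Longrightarrow> x \<in> carrier M" "\<zero>\<^bsub>M\<^esub> \<in> N" "\<lbrakk>x \<in> N; y \<in> N\<rbrakk> \<Longrightarrow> x \<oplus>\<^bsub>M\<^esub> y \<in> N"
    "\<lbrakk>a \<in> carrier R; x \<in> N\<rbrakk> \<Longrightarrow> a \<odot>\<^bsub>M\<^esub> x \<in> N" "x \<in> N \<Longrightarrow> \<ominus>\<^bsub>M\<^esub> x \<in> N"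
    using mem_carrier one_closed m_closed m_inv_closed by (auto simp: a_inv_def)
qed

lemma rmod_hom_abelian_group_hom:
  assumes "right_module R M" "right_module R N" "f \<in> rmod_hom R M N"
  shows "abelian_group_hom M N f"
proof -
  interpret M: right_module R M by fact
  interpret N: right_module R N by fact
  show ?thesis
    by (rule abelian_group_homI)
      (use assms(3) in \<open>auto simp: rmod_hom_def group_hom_def group_hom_axioms_def
        M.M.a_group N.M.a_group M.M.abelian_group_axioms N.M.abelian_group_axioms\<close>)
qed

lemma rmod_hom_comp:
  assumes "f \<in> rmod_hom R M N" "g \<in> rmod_hom R N P"
  shows "(\<lambda>x. g (f x)) \<in> rmod_hom R M P"
  using rmod_homD[OF assms(1)] rmod_homD[OF assms(2)] by (intro rmod_homI) auto

lemma submodule_image: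
  assumes M: "right_module R M" and N: "right_module R N" and f: "f \<in> rmod_hom R M N"
  shows "submodule (f ` carrier M) R N"
proof -
  interpret M: right_module R M by fact
  interpret N: right_module R N by fact
  interpret f: abelian_group_hom M N f by (rule rmod_hom_abelian_group_hom[OF assms])
  show ?thesis
  proof (rule N.submoduleI)
    show "\<zero>\<^bsub>N\<^esub> \<in> f ` carrier M"
      using f.hom_zero by (metis M.M.zero_closed image_eqI)
    show "x \<oplus>\<^bsub>N\<^esub> y \<in> f ` carrier M" if "x \<in> f ` carrier M" "y \<in> f ` carrier M" for x y
      using that by (auto simp flip: f.hom_add)
    show "a \<odot>\<^bsub>N\<^esub> x \<in> f ` carrier M" if "a \<in> carrier R" "x \<in> f ` carrier M" for a x
      using that by (auto simp flip: rmod_homD(3)[OF f])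
  qed auto
qed

lemma submodule_kernel:
  assumes M: "right_module R M" and N: "right_module R N" and f: "f \<in> rmod_hom R M N"
  shows "submodule (a_kernel M N f) R M"
proof -
  interpret M: right_module R M by fact
  interpret N: right_module R N by fact
  interpret f: abelian_group_hom M N f by (rule rmod_hom_abelian_group_hom[OF assms])
  show ?thesis
    by (rule M.submoduleI) (auto simp: a_kernel_def' rmod_homD(3)[OF f])
qed

text \<open>The module axioms are equations, apart from closure and the existence of negatives, so
  they pass along a surjection that preserves the operations. As \<open>Y\<close> is not yet known
  to be a group, preservation of zero does not follow from \<open>g \<in> rmod_hom R M Y\<close> and
  is assumed separately. The module structure of quotients is obtained this way.\<close>

lemma right_module_image:
  assumes M: "right_module R M" and surj: "g ` carrier M = carrier Y"
    and g: "g \<in> rmod_hom R M Y" and zero: "g \<zero>\<^bsub>M\<^esub> = \<zero>\<^bsub>Y\<^esub>"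
  shows "right_module R Y"
proof -
  interpret M: right_module R M by fact
  note gs = rmod_homD(2,3)[OF g, symmetric]
  have Y: "\<exists>x\<in>carrier M. y = g x" if "y \<in> carrier Y" for y
    using that surj by blast
  have ag: "abelian_group Y"
  proof (rule abelian_groupI)
    fix x y z assume "x \<in> carrier Y" "y \<in> carrier Y" "z \<in> carrier Y"
    then obtain u v w where "u \<in> carrier M" "v \<in> carrier M" "w \<in> carrier M"
      "x = g u" "y = g v" "z = g w"
      using Y by metis
    then show "x \<oplus>\<^bsub>Y\<^esub> y \<oplus>\<^bsub>Y\<^esub> z = x \<oplus>\<^bsub>Y\<^esub> (y \<oplus>\<^bsub>Y\<^esub> z)"
      by (simp add: gs M.M.a_assoc)
  next
    fix x y assume "x \<in> carrier Y" "y \<in> carrier Y"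
    then obtain u v where "u \<in> carrier M" "v \<in> carrier M" "x = g u" "y = g v"
      using Y by metis
    then show "x \<oplus>\<^bsub>Y\<^esub> y \<in> carrier Y" "x \<oplus>\<^bsub>Y\<^esub> y = y \<oplus>\<^bsub>Y\<^esub> x"
      using surj by (auto simp: gs M.M.a_comm)
  next
    show "\<zero>\<^bsub>Y\<^esub> \<in> carrier Y"
      using surj zero by (metis M.M.zero_closed image_eqI)
  next
    fix x assume "x \<in> carrier Y"
    then obtain u where u: "u \<in> carrier M" "x = g u"
      using Y by metis
    then show "\<zero>\<^bsub>Y\<^esub> \<oplus>\<^bsub>Y\<^esub> x = x"
      by (simp add: gs flip: zero)
    show "\<exists>y\<in>carrier Y. y \<oplus>\<^bsub>Y\<^esub> x = \<zero>\<^bsub>Y\<^esub>"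
      using u surj by (intro bexI[of _ "g (\<ominus>\<^bsub>M\<^esub> u)"]) (auto simp: gs M.M.l_neg simp flip: zero)
  qed
  show ?thesis
  proof (intro right_module.intro right_module_axioms.intro ag M.R.ring_axioms)
    fix a x assume "a \<in> carrier R" "x \<in> carrier Y"
    then show "a \<odot>\<^bsub>Y\<^esub> x \<in> carrier Y"
      using Y[of x] rmod_homD(1)[OF g] by (auto simp: gs)
  next
    fix a b x assume "a \<in> carrier R" "b \<in> carrier R" "x \<in> carrier Y"
    then show "(a \<oplus>\<^bsub>R\<^esub> b) \<odot>\<^bsub>Y\<^esub> x = a \<odot>\<^bsub>Y\<^esub> x \<oplus>\<^bsub>Y\<^esub> b \<odot>\<^bsub>Y\<^esub> x"
      and "(a \<otimes>\<^bsub>R\<^esub> b) \<odot>\<^bsub>Y\<^esub> x = b \<odot>\<^bsub>Y\<^esub> (a \<odot>\<^bsub>Y\<^esub> x)"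
      using Y[of x] by (auto simp: gs M.rsmult_ring_distr M.rsmult_assoc)
  next
    fix a x y assume "a \<in> carrier R" "x \<in> carrier Y" "y \<in> carrier Y"
    then show "a \<odot>\<^bsub>Y\<^esub> (x \<oplus>\<^bsub>Y\<^esub> y) = a \<odot>\<^bsub>Y\<^esub> x \<oplus>\<^bsub>Y\<^esub> a \<odot>\<^bsub>Y\<^esub> y"
      using Y[of x] Y[of y] by (auto simp: gs M.rsmult_add_distr)
  next
    fix x assume "x \<in> carrier Y"
    then show "\<one>\<^bsub>R\<^esub> \<odot>\<^bsub>Y\<^esub> x = x"
      using Y[of x] by (auto simp: gs)
  qed
qed


section \<open>Submodules and quotients as modules\<close>

definition submodule_module :: "('r, 'm, 'z) module_scheme \<Rightarrow> 'm set \<Rightarrow> ('r, 'm) module"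
  where "submodule_module M N =
    \<lparr>carrier = N, monoid.mult = undefined, one = undefined,
     ring.zero = \<zero>\<^bsub>M\<^esub>, ring.add = (\<oplus>\<^bsub>M\<^esub>), smult = (\<odot>\<^bsub>M\<^esub>)\<rparr>"

lemma submodule_module_simps [simp]:
  "carrier (submodule_module M N) = N"
  "\<zero>\<^bsub>submodule_module M N\<^esub> = \<zero>\<^bsub>M\<^esub>"
  "x \<oplus>\<^bsub>submodule_module M N\<^esub> y = x \<oplus>\<^bsub>M\<^esub> y"
  "a \<odot>\<^bsub>submodule_module M N\<^esub> x = a \<odot>\<^bsub>M\<^esub> x"
  by (simp_all add: submodule_module_def)

lemma right_module_submodule:
  assumes M: "right_module R M" and N: "submodule N R M"
  shows "right_module R (submodule_module M N)"
proof -
  interpret M: right_module R M by fact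
  note D = submoduleD[OF N]
  have ag: "abelian_group (submodule_module M N)"
  proof (rule abelian_groupI)
    fix x assume "x \<in> carrier (submodule_module M N)"
    then show "\<exists>y\<in>carrier (submodule_module M N).
        y \<oplus>\<^bsub>submodule_module M N\<^esub> x = \<zero>\<^bsub>submodule_module M N\<^esub>"
      using D by (intro bexI[of _ "\<ominus>\<^bsub>M\<^esub> x"]) (auto simp: M.M.l_neg)
  qed (use D in \<open>auto simp: M.M.a_ac\<close>)
  show ?thesis
    by (intro right_module.intro right_module_axioms.intro ag M.R.ring_axioms)
      (use D in \<open>auto simp: M.rsmult_ring_distr M.rsmult_add_distr M.rsmult_assoc\<close>)
qed

text \<open>Scaling a coset elementwise can give a proper subset of a coset, because the multiples
  of \<open>N\<close> by \<open>a\<close> need not fill \<open>N\<close>. Adding \<open>N\<close>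
  again restores a full coset.\<close>

definition quotient_module :: "('r, 'm, 'z) module_scheme \<Rightarrow> 'm set \<Rightarrow> ('r, 'm set) module"
  where "quotient_module M N =
    \<lparr>carrier = a_rcosets\<^bsub>M\<^esub> N, monoid.mult = undefined, one = undefined,
     ring.zero = N, ring.add = (<+>\<^bsub>M\<^esub>), smult = (\<lambda>a C. N <+>\<^bsub>M\<^esub> (\<odot>\<^bsub>M\<^esub>) a ` C)\<rparr>"

context
  fixes R :: "('r, 'q) ring_scheme" and M :: "('r, 'm, 'z) module_scheme" and N
  assumes M: "right_module R M" and N: "submodule N R M"
begin

interpretation M: right_module R M by (rule M)

interpretation N: abelian_subgroup N M
  using N M.M.abelian_group_axioms
  by (intro abelian_subgroupI3 additive_subgroup.intro) (auto simp: submodule_def)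

lemma quotient_map_surj: "(\<lambda>x. N +>\<^bsub>M\<^esub> x) ` carrier M = carrier (quotient_module M N)"
  by (auto simp: quotient_module_def A_RCOSETS_def')

lemma quotient_map_hom: "(\<lambda>x. N +>\<^bsub>M\<^esub> x) \<in> rmod_hom R M (quotient_module M N)"
proof (rule rmod_homI)
  fix a x assume a: "a \<in> carrier R" and x: "x \<in> carrier M"
  \<comment> \<open>\<open>?r h k\<close> is a typical element of the scaled coset. The choice of
    zero for \<open>k\<close> gives one inclusion; distributing \<open>a\<close> over
    \<open>k \<oplus> x\<close> and absorbing the multiple of \<open>k\<close> into \<open>N\<close>
    gives the other.\<close>
  let ?r = "\<lambda>h k. h \<oplus>\<^bsub>M\<^esub> a \<odot>\<^bsub>M\<^esub> (k \<oplus>\<^bsub>M\<^esub> x)"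
  have quot: "a \<odot>\<^bsub>quotient_module M N\<^esub> (N +>\<^bsub>M\<^esub> x) = {?r h k | h k. h \<in> N \<and> k \<in> N}"
    by (auto simp: quotient_module_def a_r_coset_def' set_add_def')
  have coset: "N +>\<^bsub>M\<^esub> (a \<odot>\<^bsub>M\<^esub> x) = {h \<oplus>\<^bsub>M\<^esub> a \<odot>\<^bsub>M\<^esub> x | h. h \<in> N}"
    by (auto simp: a_r_coset_def')
  have "?r h \<zero>\<^bsub>M\<^esub> = h \<oplus>\<^bsub>M\<^esub> a \<odot>\<^bsub>M\<^esub> x" for h
    using x by simp
  then have "N +>\<^bsub>M\<^esub> (a \<odot>\<^bsub>M\<^esub> x) \<subseteq> a \<odot>\<^bsub>quotient_module M N\<^esub> (N +>\<^bsub>M\<^esub> x)"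
    unfolding quot coset using submoduleD(2)[OF N] by (smt (verit) mem_Collect_eq subsetI)
  moreover have "?r h k = (h \<oplus>\<^bsub>M\<^esub> a \<odot>\<^bsub>M\<^esub> k) \<oplus>\<^bsub>M\<^esub> a \<odot>\<^bsub>M\<^esub> x" "h \<oplus>\<^bsub>M\<^esub> a \<odot>\<^bsub>M\<^esub> k \<in> N"
    if "h \<in> N" "k \<in> N" for h k
    using that a x submoduleD[OF N] by (auto simp: M.rsmult_add_distr M.M.a_assoc)
  then have "a \<odot>\<^bsub>quotient_module M N\<^esub> (N +>\<^bsub>M\<^esub> x) \<subseteq> N +>\<^bsub>M\<^esub> (a \<odot>\<^bsub>M\<^esub> x)"
    unfolding quot coset by blast
  ultimately show "N +>\<^bsub>M\<^esub> (a \<odot>\<^bsub>M\<^esub> x) = a \<odot>\<^bsub>quotient_module M N\<^esub> (N +>\<^bsub>M\<^esub> x)"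
    by (rule antisym)
qed (use N.a_rcos_sum quotient_map_surj in \<open>auto simp: quotient_module_def\<close>)

lemma quotient_map_zero: "N +>\<^bsub>M\<^esub> \<zero>\<^bsub>M\<^esub> = \<zero>\<^bsub>quotient_module M N\<^esub>"
  by (simp add: quotient_module_def N.a_subset)

lemma right_module_quotient: "right_module R (quotient_module M N)"
  by (rule right_module_image[OF M quotient_map_surj quotient_map_hom quotient_map_zero])

lemma quotient_map_eq_iff:
  assumes "x \<in> carrier M" "y \<in> carrier M"
  shows "N +>\<^bsub>M\<^esub> x = N +>\<^bsub>M\<^esub> y \<longleftrightarrow> x \<ominus>\<^bsub>M\<^esub> y \<in> N"
  using assms N.a_rcos_module N.a_repr_independence' N.a_rcos_self M.M.minus_eq by metis

lemma quotient_map_kernel: "a_kernel M (quotient_module M N) (\<lambda>x. N +>\<^bsub>M\<^esub> x) = N"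
proof -
  have "N +>\<^bsub>M\<^esub> x = N \<longleftrightarrow> x \<in> N" if "x \<in> carrier M" for x
    using that N.a_rcos_self[OF that] N.a_subgroup M.M.a_coset_join2 by auto
  then show ?thesis
    using N.a_subset by (auto simp: a_kernel_def' quotient_module_def)
qed

text \<open>This sequence is the one to which the splitting hypotheses are applied when the Baer and
  dual Baer properties are derived.\<close>

lemma short_exact_quotient:
  "short_exact R (submodule_module M N) M (quotient_module M N) (\<lambda>x. x) (\<lambda>x. N +>\<^bsub>M\<^esub> x)"
  unfolding short_exact_def
proof (intro conjI)
  show "(\<lambda>x. x) \<in> rmod_hom R (submodule_module M N) M"
    using submoduleD(1)[OF N] by (intro rmod_homI) auto
  show "right_module R (submodule_module M N)"
    by (rule right_module_submodule[OF M N])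
  show "right_module R M"
    by (rule M)
  show "right_module R (quotient_module M N)"
    by (rule right_module_quotient)
  show "(\<lambda>x. N +>\<^bsub>M\<^esub> x) \<in> rmod_hom R M (quotient_module M N)"
    by (rule quotient_map_hom)
  show "inj_on (\<lambda>x. x) (carrier (submodule_module M N))"
    by (rule inj_on_id2)
  show "(\<lambda>x. x) ` carrier (submodule_module M N) =
      a_kernel M (quotient_module M N) (\<lambda>x. N +>\<^bsub>M\<^esub> x)"
    by (simp add: quotient_map_kernel)
  show "(\<lambda>x. N +>\<^bsub>M\<^esub> x) ` carrier M = carrier (quotient_module M N)"
    by (rule quotient_map_surj)
qed

end


section \<open>Splittings, retractions and direct summands\<close>

context
  fixes R :: "('r, 'q) ring_scheme" and M :: "('r, 'm, 'z) module_scheme"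
    and Y :: "('r, 'y, 'w) module_scheme" and g
  assumes M: "right_module R M" and Y: "right_module R Y"
    and g: "g \<in> rmod_hom R M Y" and surj: "g ` carrier M = carrier Y"
begin

interpretation M: right_module R M by (rule M)
interpretation Y: right_module R Y by (rule Y)
interpretation g: abelian_group_hom M Y g
  by (rule rmod_hom_abelian_group_hom[OF M Y g])

text \<open>On a complement \<open>K\<close> of the kernel, \<open>g\<close> is injective and still
  reaches all of \<open>Y\<close>; its inverse there is the section.\<close>

lemma direct_summand_kernel_imp_splits:
  assumes "direct_summand (a_kernel M Y g) R M"
  shows "splits R M Y g"
proof -
  obtain K where K: "submodule K R M" and sum: "a_kernel M Y g <+>\<^bsub>M\<^esub> K = carrier M"
    and disj: "a_kernel M Y g \<inter> K = {\<zero>\<^bsub>M\<^esub>}"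
    using assms unfolding direct_summand_def by blast
  note KD = submoduleD[OF K]
  define s where "s = inv_into K g"
  have inj: "x = y" if "x \<in> K" "y \<in> K" "g x = g y" for x y
  proof -
    have "x \<ominus>\<^bsub>M\<^esub> y \<in> a_kernel M Y g \<inter> K"
      using that KD by (auto simp: a_kernel_def' M.M.minus_eq Y.M.r_neg)
    then have eq: "x \<oplus>\<^bsub>M\<^esub> \<ominus>\<^bsub>M\<^esub> y = \<zero>\<^bsub>M\<^esub>"
      using disj by (simp add: M.M.minus_eq)
    have xy: "x \<in> carrier M" "y \<in> carrier M"
      using that KD(1) by blast+
    then have "\<ominus>\<^bsub>M\<^esub> (\<ominus>\<^bsub>M\<^esub> y) = x"
      by (intro M.M.minus_equality eq) auto
    then show ?thesis
      using xy(2) by simp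
  qed
  have "\<exists>k\<in>K. g k = y" if "y \<in> carrier Y" for y
  proof -
    have "y \<in> g ` carrier M"
      unfolding surj by (rule that)
    then obtain m where m: "y = g m" "m \<in> carrier M"
      by (rule imageE)
    then obtain n k where "n \<in> a_kernel M Y g" "k \<in> K" "m = n \<oplus>\<^bsub>M\<^esub> k"
      using sum unfolding set_add_def' by blast
    then have "g k = y"
      using m KD(1) by (auto simp: a_kernel_def')
    then show ?thesis
      using \<open>k \<in> K\<close> by blast
  qed
  then have "carrier Y \<subseteq> g ` K"
    by blast
  then have s: "s y \<in> K" "g (s y) = y" if "y \<in> carrier Y" for y
    using that unfolding s_def by (auto simp: inv_into_into f_inv_into_f subset_iff)
  \<comment> \<open>Both sides of each equation lie in \<open>K\<close> and have the same image
    under \<open>g\<close>, so injectivity on \<open>K\<close> identifies them.\<close>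
  have "s \<in> rmod_hom R Y M"
  proof (rule rmod_homI)
    show "s x \<in> carrier M" if "x \<in> carrier Y" for x
      using s(1) KD(1) that by blast
    show "s (x \<oplus>\<^bsub>Y\<^esub> y) = s x \<oplus>\<^bsub>M\<^esub> s y" if "x \<in> carrier Y" "y \<in> carrier Y" for x y
      using that s KD by (intro inj) auto
    show "s (a \<odot>\<^bsub>Y\<^esub> x) = a \<odot>\<^bsub>M\<^esub> s x" if "a \<in> carrier R" "x \<in> carrier Y" for a x
      using that s KD by (intro inj) (auto simp: rmod_homD(3)[OF g])
  qed
  then show ?thesis
    unfolding splits_def using s(2) by blast
qed

lemma splits_imp_retraction:
  assumes "splits R M Y g"
  obtains e where "e \<in> rmod_hom R M M" "e ` carrier M \<subseteq> a_kernel M Y g"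
    "\<And>x. x \<in> a_kernel M Y g \<Longrightarrow> e x = x"
proof -
  obtain s where s: "s \<in> rmod_hom R Y M" and gs: "\<And>y. y \<in> carrier Y \<Longrightarrow> g (s y) = y"
    using assms unfolding splits_def by blast
  interpret s: abelian_group_hom Y M s
    by (rule rmod_hom_abelian_group_hom[OF Y M s])
  \<comment> \<open>This is the projection of \<open>M\<close> onto the kernel along the image of
    \<open>s\<close>: \<open>g\<close> kills \<open>e x\<close> because
    \<open>g (s (g x)) = g x\<close>, and \<open>s (g x)\<close> vanishes when \<open>x\<close> is
    in the kernel.\<close>
  define e where "e = (\<lambda>x. x \<ominus>\<^bsub>M\<^esub> s (g x))"
  show thesis
  proof
    show "e \<in> rmod_hom R M M"
      by (rule rmod_homI)
        (auto simp: e_def M.M.minus_eq M.M.minus_add M.M.a_ac rmod_homD(3)[OF g]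
          rmod_homD(3)[OF s] M.rsmult_add_distr M.rsmult_minus)
    show "e ` carrier M \<subseteq> a_kernel M Y g"
      by (auto simp: e_def a_kernel_def' M.M.minus_eq gs Y.M.r_neg)
    show "e x = x" if "x \<in> a_kernel M Y g" for x
      using that by (auto simp: e_def a_kernel_def' M.M.minus_eq)
  qed
qed

end

text \<open>The complement is the kernel of \<open>e\<close>, through the decomposition of
  \<open>x\<close> into \<open>e x\<close> and \<open>x \<ominus> e x\<close>.\<close>

lemma retraction_imp_direct_summand:
  assumes M: "right_module R M" and N: "submodule N R M" and e: "e \<in> rmod_hom R M M"
    and into: "e ` carrier M \<subseteq> N" and ident: "\<And>x. x \<in> N \<Longrightarrow> e x = x"
  shows "direct_summand N R M"
proof -
  interpret M: right_module R M by fact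
  interpret e: abelian_group_hom M M e
    by (rule rmod_hom_abelian_group_hom[OF M M e])
  note ND = submoduleD[OF N]
  have ee: "e (e x) = e x" if "x \<in> carrier M" for x
    using that into by (auto intro!: ident)
  have "carrier M \<subseteq> N <+>\<^bsub>M\<^esub> a_kernel M M e"
  proof
    fix x assume x: "x \<in> carrier M"
    then have "x = e x \<oplus>\<^bsub>M\<^esub> (x \<ominus>\<^bsub>M\<^esub> e x)"
      by (simp add: M.M.minus_eq M.M.a_lcomm M.M.r_neg)
    moreover have "x \<ominus>\<^bsub>M\<^esub> e x \<in> a_kernel M M e"
      using x by (simp add: a_kernel_def' M.M.minus_eq ee M.M.r_neg)
    ultimately show "x \<in> N <+>\<^bsub>M\<^esub> a_kernel M M e"
      unfolding set_add_def' using into x by blast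
  qed
  moreover have "N <+>\<^bsub>M\<^esub> a_kernel M M e \<subseteq> carrier M"
    using ND(1) by (auto simp: set_add_def' a_kernel_def')
  moreover have "N \<inter> a_kernel M M e = {\<zero>\<^bsub>M\<^esub>}"
    using ND(2) ident by (auto simp: a_kernel_def')
  ultimately show ?thesis
    unfolding direct_summand_def using N submodule_kernel[OF M M e] by blast
qed


section \<open>Direct sums of copies of a module\<close>

text \<open>For \<open>l \<in> \<Lambda>\<close> this is the canonical injection of the
  \<open>l\<close>-th summand into \<open>M^(\<Lambda>)\<close>.\<close>

definition copower_single :: "('r, 'm, 'z) module_scheme \<Rightarrow> 'l set \<Rightarrow> 'l \<Rightarrow> 'm \<Rightarrow> 'l \<Rightarrow> 'm"
  where "copower_single M \<Lambda> l m = (\<lambda>k\<in>\<Lambda>. if k = l then m else \<zero>\<^bsub>M\<^esub>)"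

lemma module_copower_simps:
  "u \<in> carrier (module_copower M \<Lambda>) \<longleftrightarrow>
     u \<in> (\<Pi>\<^sub>E l\<in>\<Lambda>. carrier M) \<and> finite {l \<in> \<Lambda>. u l \<noteq> \<zero>\<^bsub>M\<^esub>}"
  "\<zero>\<^bsub>module_copower M \<Lambda>\<^esub> = (\<lambda>l\<in>\<Lambda>. \<zero>\<^bsub>M\<^esub>)"
  "u \<oplus>\<^bsub>module_copower M \<Lambda>\<^esub> v = (\<lambda>l\<in>\<Lambda>. u l \<oplus>\<^bsub>M\<^esub> v l)"
  "a \<odot>\<^bsub>module_copower M \<Lambda>\<^esub> u = (\<lambda>l\<in>\<Lambda>. a \<odot>\<^bsub>M\<^esub> u l)"
  by (auto simp: module_copower_def module_power_def)

context right_module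
begin

text \<open>\<open>F\<close> may be any finite set containing the support, so the supports of the
  arguments certify sums, multiples and negatives.\<close>

lemma copowerI:
  assumes "finite F" and "\<And>l. l \<in> \<Lambda> \<Longrightarrow> u l \<in> carrier M"
    and "\<And>l. \<lbrakk>l \<in> \<Lambda>; l \<notin> F\<rbrakk> \<Longrightarrow> u l = \<zero>\<^bsub>M\<^esub>"
  shows "restrict u \<Lambda> \<in> carrier (module_copower M \<Lambda>)"
proof -
  have "{l \<in> \<Lambda>. restrict u \<Lambda> l \<noteq> \<zero>\<^bsub>M\<^esub>} \<subseteq> F"
    using assms(3) by auto
  then show ?thesis
    using assms(2) finite_subset[OF _ assms(1)] by (auto simp: module_copower_simps)
qed

lemma copower_mem:
  assumes "u \<in> carrier (module_copower M \<Lambda>)" "l \<in> \<Lambda>"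
  shows "u l \<in> carrier M"
  using assms by (auto simp: module_copower_simps)

lemma copower_ext:
  assumes "u \<in> carrier (module_copower M \<Lambda>)" "v \<in> carrier (module_copower M \<Lambda>)"
    and "\<And>l. l \<in> \<Lambda> \<Longrightarrow> u l = v l"
  shows "u = v"
proof (rule PiE_ext)
  show "u \<in> (\<Pi>\<^sub>E l\<in>\<Lambda>. carrier M)" "v \<in> (\<Pi>\<^sub>E l\<in>\<Lambda>. carrier M)"
    using assms(1,2) by (simp_all add: module_copower_simps(1))
qed (rule assms(3))

lemma copower_zero_closed: "\<zero>\<^bsub>module_copower M \<Lambda>\<^esub> \<in> carrier (module_copower M \<Lambda>)"
  unfolding module_copower_simps(2) by (rule copowerI[of "{}"]) auto

lemma copower_add_closed:
  assumes "u \<in> carrier (module_copower M \<Lambda>)" "v \<in> carrier (module_copower M \<Lambda>)"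
  shows "u \<oplus>\<^bsub>module_copower M \<Lambda>\<^esub> v \<in> carrier (module_copower M \<Lambda>)"
  unfolding module_copower_simps(3)
  by (rule copowerI[of "{l \<in> \<Lambda>. u l \<noteq> \<zero>\<^bsub>M\<^esub>} \<union> {l \<in> \<Lambda>. v l \<noteq> \<zero>\<^bsub>M\<^esub>}"])
    (use assms copower_mem in \<open>auto simp: module_copower_simps(1)\<close>)

lemma copower_smult_closed:
  assumes "a \<in> carrier R" "u \<in> carrier (module_copower M \<Lambda>)"
  shows "a \<odot>\<^bsub>module_copower M \<Lambda>\<^esub> u \<in> carrier (module_copower M \<Lambda>)"
  unfolding module_copower_simps(4)
  by (rule copowerI[of "{l \<in> \<Lambda>. u l \<noteq> \<zero>\<^bsub>M\<^esub>}"])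
    (use assms copower_mem in \<open>auto simp: module_copower_simps(1)\<close>)

lemma right_module_copower: "right_module R (module_copower M \<Lambda>)"
proof -
  let ?C = "module_copower M \<Lambda>"
  note closed = copower_zero_closed copower_add_closed copower_smult_closed
  note val = module_copower_simps(2-4)
  have ag: "abelian_group ?C"
  proof (rule abelian_groupI)
    fix u assume u: "u \<in> carrier ?C"
    have n: "(\<lambda>l\<in>\<Lambda>. \<ominus>\<^bsub>M\<^esub> u l) \<in> carrier ?C"
      by (rule copowerI[of "{l \<in> \<Lambda>. u l \<noteq> \<zero>\<^bsub>M\<^esub>}"])
        (use u copower_mem in \<open>auto simp: module_copower_simps(1)\<close>)
    show "\<exists>v\<in>carrier ?C. v \<oplus>\<^bsub>?C\<^esub> u = \<zero>\<^bsub>?C\<^esub>"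
      by (rule bexI[OF _ n], rule copower_ext[OF closed(2)[OF n u] closed(1)])
        (simp add: val copower_mem[OF u] M.l_neg)
    show "\<zero>\<^bsub>?C\<^esub> \<oplus>\<^bsub>?C\<^esub> u = u"
      by (rule copower_ext[OF closed(2)[OF closed(1) u] u]) (simp add: val copower_mem[OF u])
  next
    fix u v assume "u \<in> carrier ?C" "v \<in> carrier ?C"
    then show "u \<oplus>\<^bsub>?C\<^esub> v = v \<oplus>\<^bsub>?C\<^esub> u"
      by (auto simp: val copower_mem M.a_comm intro!: restrict_ext)
  next
    fix u v w assume "u \<in> carrier ?C" "v \<in> carrier ?C" "w \<in> carrier ?C"
    then show "u \<oplus>\<^bsub>?C\<^esub> v \<oplus>\<^bsub>?C\<^esub> w = u \<oplus>\<^bsub>?C\<^esub> (v \<oplus>\<^bsub>?C\<^esub> w)"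
      by (auto simp: val copower_mem M.a_assoc intro!: restrict_ext)
  qed (use closed in auto)
  show ?thesis
  proof (intro right_module.intro right_module_axioms.intro ag R.ring_axioms)
    fix u assume u: "u \<in> carrier ?C"
    show "\<one>\<^bsub>R\<^esub> \<odot>\<^bsub>?C\<^esub> u = u"
      by (rule copower_ext[OF closed(3)[OF R.one_closed u] u]) (simp add: val copower_mem[OF u])
  qed (use closed in \<open>auto simp: val copower_mem rsmult_ring_distr rsmult_add_distr rsmult_assoc
      intro!: restrict_ext\<close>)
qed

lemma copower_single_hom:
  "copower_single M \<Lambda> l \<in> rmod_hom R M (module_copower M \<Lambda>)"
proof (rule rmod_homI)
  show "copower_single M \<Lambda> l m \<in> carrier (module_copower M \<Lambda>)" if "m \<in> carrier M" for m
    unfolding copower_single_def using that by (intro copowerI[of "{l}"]) auto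
  show "copower_single M \<Lambda> l (x \<oplus>\<^bsub>M\<^esub> y) =
      copower_single M \<Lambda> l x \<oplus>\<^bsub>module_copower M \<Lambda>\<^esub> copower_single M \<Lambda> l y" if "x \<in> carrier M" "y \<in> carrier M" for x y
    using that by (auto simp: copower_single_def module_copower_simps(3) intro!: restrict_ext)
qed (auto simp: copower_single_def module_copower_simps(4) intro!: restrict_ext)

text \<open>A finitely supported family is built from zero by adding one coordinate at a time.
  Properties of elements of \<open>M^(\<Lambda>)\<close> thus reduce to the canonical
  injections.\<close>

lemma copower_induct [consumes 1, case_names zero add]:
  assumes "u \<in> carrier (module_copower M \<Lambda>)"
    and zero: "P \<zero>\<^bsub>module_copower M \<Lambda>\<^esub>"
    and add: "\<And>l m v. \<lbrakk>l \<in> \<Lambda>; m \<in> carrier M; v \<in> carrier (module_copower M \<Lambda>); P v\<rbrakk>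
      \<Longrightarrow> P (copower_single M \<Lambda> l m \<oplus>\<^bsub>module_copower M \<Lambda>\<^esub> v)"
  shows "P u"
proof -
  let ?C = "module_copower M \<Lambda>"
  have "P u" if "finite F" "F \<subseteq> \<Lambda>" "u \<in> carrier ?C" "\<And>l. \<lbrakk>l \<in> \<Lambda>; l \<notin> F\<rbrakk> \<Longrightarrow> u l = \<zero>\<^bsub>M\<^esub>" for F u
    using that
  proof (induction F arbitrary: u rule: finite_induct)
    case empty
    have "u = \<zero>\<^bsub>?C\<^esub>"
      by (rule copower_ext[OF empty(2) copower_zero_closed])
        (simp add: empty(3) module_copower_simps(2))
    then show ?case
      using zero by simp
  next
    case (insert l F)
    \<comment> \<open>\<open>v\<close> is \<open>u\<close> with coordinate \<open>l\<close> erased,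
      so its support lies in the smaller set \<open>F\<close>.\<close>
    define v where "v = (\<lambda>k\<in>\<Lambda>. if k = l then \<zero>\<^bsub>M\<^esub> else u k)"
    have v: "v \<in> carrier ?C"
      unfolding v_def using insert.hyps(1) insert.prems copower_mem[OF insert.prems(2)]
      by (intro copowerI[of F]) auto
    have l: "l \<in> \<Lambda>" and ul: "u l \<in> carrier M"
      using insert.prems copower_mem by auto
    have "P v"
      by (rule insert.IH[OF _ v]) (use insert.prems in \<open>auto simp: v_def\<close>)
    moreover have "u = copower_single M \<Lambda> l (u l) \<oplus>\<^bsub>?C\<^esub> v"
      by (rule copower_ext[OF insert.prems(2)
            copower_add_closed[OF rmod_homD(1)[OF copower_single_hom ul] v]])
        (use copower_mem[OF insert.prems(2)] in
          \<open>auto simp: module_copower_simps(3) copower_single_def v_def\<close>)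
    ultimately show ?case
      using add[OF l ul v] by simp
  qed
  from this[of "{l \<in> \<Lambda>. u l \<noteq> \<zero>\<^bsub>M\<^esub>}" u] assms(1) show ?thesis
    by (auto simp: module_copower_simps(1))
qed

lemma rsmult_finsum:
  assumes "finite F" "a \<in> carrier R" "h \<in> F \<rightarrow> carrier M"
  shows "a \<odot>\<^bsub>M\<^esub> (\<Oplus>\<^bsub>M\<^esub>l\<in>F. h l) = (\<Oplus>\<^bsub>M\<^esub>l\<in>F. a \<odot>\<^bsub>M\<^esub> h l)"
  using assms
proof (induction F rule: finite_induct)
  case (insert l F)
  then have "(\<lambda>l. a \<odot>\<^bsub>M\<^esub> h l) \<in> F \<rightarrow> carrier M" "h \<in> F \<rightarrow> carrier M" "h l \<in> carrier M"
    by auto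
  with insert show ?case
    by (simp add: M.finsum_insert rsmult_add_distr M.finsum_closed)
qed simp

end

text \<open>The index set consists of maps: each \<open>h \<in> \<Lambda>\<close> is evaluated at
  its own coordinate. For homomorphisms this is the map \<open>M^(\<Lambda>) \<rightarrow> Y\<close>
  induced by the universal property of the direct sum. Summing over the support keeps the sum finite
  when \<open>\<Lambda>\<close> is infinite.\<close>

definition copower_sum ::
  "('r, 'm, 'z) module_scheme \<Rightarrow> ('r, 'y, 'w) module_scheme \<Rightarrow> ('m \<Rightarrow> 'y) set \<Rightarrow>
   (('m \<Rightarrow> 'y) \<Rightarrow> 'm) \<Rightarrow> 'y"
  where "copower_sum M Y \<Lambda> u = (\<Oplus>\<^bsub>Y\<^esub>h\<in>{h \<in> \<Lambda>. u h \<noteq> \<zero>\<^bsub>M\<^esub>}. h (u h))"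

context
  fixes R :: "('r, 'q) ring_scheme" and M :: "('r, 'm, 'z) module_scheme"
    and Y :: "('r, 'y, 'w) module_scheme" and \<Lambda> :: "('m \<Rightarrow> 'y) set"
  assumes M: "right_module R M" and Y: "right_module R Y" and \<Lambda>: "\<Lambda> \<subseteq> rmod_hom R M Y"
begin

interpretation M: right_module R M by (rule M)
interpretation Y: right_module R Y by (rule Y)

lemma copower_sum_term_closed:
  assumes "u \<in> carrier (module_copower M \<Lambda>)" "h \<in> \<Lambda>"
  shows "h (u h) \<in> carrier Y"
  by (rule rmod_homD(1)[OF subsetD[OF \<Lambda> assms(2)] M.copower_mem[OF assms]])

text \<open>The additional terms are zero because each \<open>h\<close> preserves zero. Sums with
  different supports can therefore be compared over one common finite set.\<close>

lemma copower_sum_eq: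
  assumes u: "u \<in> carrier (module_copower M \<Lambda>)" and F: "finite F" "F \<subseteq> \<Lambda>"
    and supp: "\<And>h. \<lbrakk>h \<in> \<Lambda>; h \<notin> F\<rbrakk> \<Longrightarrow> u h = \<zero>\<^bsub>M\<^esub>"
  shows "copower_sum M Y \<Lambda> u = (\<Oplus>\<^bsub>Y\<^esub>h\<in>F. h (u h))"
  unfolding copower_sum_def
proof (rule Y.M.add.finprod_mono_neutral_cong_left)
  show "h (u h) = \<zero>\<^bsub>Y\<^esub>" if "h \<in> F - {h \<in> \<Lambda>. u h \<noteq> \<zero>\<^bsub>M\<^esub>}" for h
    using that F \<Lambda> abelian_group_hom.hom_zero[OF rmod_hom_abelian_group_hom[OF M Y]] by auto
  show "{h \<in> \<Lambda>. u h \<noteq> \<zero>\<^bsub>M\<^esub>} \<subseteq> F"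
    using supp by blast
  show "(\<lambda>h. h (u h)) \<in> F \<rightarrow> carrier Y"
    using F(2) copower_sum_term_closed[OF u] by blast
qed (rule F(1) refl)+

lemma copower_sum_hom: "copower_sum M Y \<Lambda> \<in> rmod_hom R (module_copower M \<Lambda>) Y"
proof (rule rmod_homI)
  let ?C = "module_copower M \<Lambda>"
  let ?S = "\<lambda>u. {h \<in> \<Lambda>. u h \<noteq> \<zero>\<^bsub>M\<^esub>}"
  note closed = copower_sum_term_closed
  fix u assume u: "u \<in> carrier ?C"
  then show "copower_sum M Y \<Lambda> u \<in> carrier Y"
    unfolding copower_sum_def using closed by (intro Y.M.finsum_closed) auto
  have finu: "finite (?S u)"
    using u by (simp add: module_copower_simps(1))
  {
    fix v assume v: "v \<in> carrier ?C"
    \<comment> \<open>Contains the supports of \<open>u\<close>, \<open>v\<close> and their sum; the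
      latter may be smaller through cancellation.\<close>
    let ?F = "?S u \<union> ?S v"
    have finv: "finite (?S v)"
      using v by (simp add: module_copower_simps(1))
    have "copower_sum M Y \<Lambda> (u \<oplus>\<^bsub>?C\<^esub> v) = (\<Oplus>\<^bsub>Y\<^esub>h\<in>?F. h ((u \<oplus>\<^bsub>?C\<^esub> v) h))"
      using finu finv
      by (intro copower_sum_eq M.copower_add_closed u v) (auto simp: module_copower_simps(3))
    also have "\<dots> = (\<Oplus>\<^bsub>Y\<^esub>h\<in>?F. h (u h) \<oplus>\<^bsub>Y\<^esub> h (v h))"
    proof (rule Y.M.finsum_cong')
      show "h ((u \<oplus>\<^bsub>?C\<^esub> v) h) = h (u h) \<oplus>\<^bsub>Y\<^esub> h (v h)" if "h \<in> ?F" for h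
        using that \<Lambda> rmod_homD(2)[of h R M Y] M.copower_mem[OF u] M.copower_mem[OF v]
        by (auto simp: module_copower_simps(3))
    qed (use closed[OF u] closed[OF v] in auto)
    also have "\<dots> = (\<Oplus>\<^bsub>Y\<^esub>h\<in>?F. h (u h)) \<oplus>\<^bsub>Y\<^esub> (\<Oplus>\<^bsub>Y\<^esub>h\<in>?F. h (v h))"
      using closed[OF u] closed[OF v] by (intro Y.M.finsum_addf) auto
    also have "(\<Oplus>\<^bsub>Y\<^esub>h\<in>?F. h (u h)) = copower_sum M Y \<Lambda> u"
      using finu finv by (intro copower_sum_eq[symmetric] u) auto
    also have "(\<Oplus>\<^bsub>Y\<^esub>h\<in>?F. h (v h)) = copower_sum M Y \<Lambda> v"
      using finu finv by (intro copower_sum_eq[symmetric] v) auto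
    finally show "copower_sum M Y \<Lambda> (u \<oplus>\<^bsub>?C\<^esub> v) = copower_sum M Y \<Lambda> u \<oplus>\<^bsub>Y\<^esub> copower_sum M Y \<Lambda> v" .
  next
    fix a assume a: "a \<in> carrier R"
    have "copower_sum M Y \<Lambda> (a \<odot>\<^bsub>?C\<^esub> u) = (\<Oplus>\<^bsub>Y\<^esub>h\<in>?S u. h ((a \<odot>\<^bsub>?C\<^esub> u) h))"
      using finu a
      by (intro copower_sum_eq M.copower_smult_closed u) (auto simp: module_copower_simps(4))
    also have "\<dots> = (\<Oplus>\<^bsub>Y\<^esub>h\<in>?S u. a \<odot>\<^bsub>Y\<^esub> h (u h))"
    proof (rule Y.M.finsum_cong')
      show "h ((a \<odot>\<^bsub>?C\<^esub> u) h) = a \<odot>\<^bsub>Y\<^esub> h (u h)" if "h \<in> ?S u" for h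
        using that a \<Lambda> rmod_homD(3)[of h R M Y] M.copower_mem[OF u]
        by (auto simp: module_copower_simps(4))
    qed (use closed[OF u] a in auto)
    also have "\<dots> = a \<odot>\<^bsub>Y\<^esub> copower_sum M Y \<Lambda> u"
      unfolding copower_sum_def using closed[OF u] finu a
      by (intro Y.rsmult_finsum[symmetric]) auto
    finally show "copower_sum M Y \<Lambda> (a \<odot>\<^bsub>?C\<^esub> u) = a \<odot>\<^bsub>Y\<^esub> copower_sum M Y \<Lambda> u" .
  }
qed

text \<open>Shows that the image of the induced map contains the image of every
  \<open>h \<in> \<Lambda>\<close>.\<close>

lemma copower_sum_single:
  assumes h: "h \<in> \<Lambda>" and m: "m \<in> carrier M"
  shows "copower_sum M Y \<Lambda> (copower_single M \<Lambda> h m) = h m"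
proof -
  let ?u = "copower_single M \<Lambda> h m"
  have u: "?u \<in> carrier (module_copower M \<Lambda>)"
    using rmod_homD(1)[OF M.copower_single_hom m] .
  have "copower_sum M Y \<Lambda> ?u = (\<Oplus>\<^bsub>Y\<^esub>k\<in>{h}. k (?u k))"
    using h by (intro copower_sum_eq u) (auto simp: copower_single_def)
  also have "\<dots> = h (?u h)"
    using copower_sum_term_closed[OF u h] by simp
  finally show ?thesis
    using h by (simp add: copower_single_def)
qed

end


section \<open>Baer and dual Baer modules through short exact sequences\<close>

lemma End_simps:
  "f \<in> carrier (End R M) \<longleftrightarrow> f \<in> rmod_hom R M M \<and> f \<in> extensional (carrier M)"
  "f \<otimes>\<^bsub>End R M\<^esub> h = compose (carrier M) f h"
  by (simp_all add: End_def)

lemma (in right_module) restrict_End: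
  assumes "f \<in> rmod_hom R M M"
  shows "restrict f (carrier M) \<in> carrier (End R M)"
  unfolding End_simps(1)
  using rmod_homD[OF assms] by (auto intro!: rmod_homI)

lemma short_exactD:
  assumes "short_exact R X M Y f g"
  shows "right_module R X" "right_module R M" "right_module R Y"
    "f \<in> rmod_hom R X M" "g \<in> rmod_hom R M Y" "f ` carrier X = a_kernel M Y g"
    "g ` carrier M = carrier Y"
  using assms by (simp_all add: short_exact_def)

lemma quotient_splits_imp_retraction:
  assumes M: "right_module R M" and N: "submodule N R M"
    and "splits R M (quotient_module M N) (\<lambda>x. N +>\<^bsub>M\<^esub> x)"
  obtains e where "e \<in> rmod_hom R M M" "e ` carrier M \<subseteq> N" "\<And>x. x \<in> N \<Longrightarrow> e x = x"
  using splits_imp_retraction[OF M right_module_quotient[OF M N] quotient_map_hom[OF M N]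
      quotient_map_surj[OF M N] assms(3)]
  unfolding quotient_map_kernel[OF M N] by metis

section \<open>Baer modules and quotients cogenerated by \<open>M\<close>\<close>

lemma power_component_hom:
  assumes "i \<in> rmod_hom R Y (module_power M \<Lambda>)" "l \<in> \<Lambda>"
  shows "(\<lambda>y. i y l) \<in> rmod_hom R Y M"
proof (rule rmod_homI)
  show "i y l \<in> carrier M" if "y \<in> carrier Y" for y
    using rmod_homD(1)[OF assms(1) that] assms(2) by (auto simp: module_power_def)
  show "i (x \<oplus>\<^bsub>Y\<^esub> y) l = i x l \<oplus>\<^bsub>M\<^esub> i y l" if "x \<in> carrier Y" "y \<in> carrier Y" for x y
    using rmod_homD(2)[OF assms(1) that] assms(2) by (simp add: module_power_def)
  show "i (a \<odot>\<^bsub>Y\<^esub> y) l = a \<odot>\<^bsub>M\<^esub> i y l" if "a \<in> carrier R" "y \<in> carrier Y" for a y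
    using rmod_homD(3)[OF assms(1) that] assms(2) by (simp add: module_power_def)
qed

lemma baer_imp_splits:
  fixes M :: "('r, 'm, 'z) module_scheme" and Y :: "('r, 'y, 'w) module_scheme"
  assumes baer: "baer_module R M" and ex: "short_exact R X M Y f g" and cog: "Y \<in> Cog R M"
  shows "splits R M Y g"
proof -
  note D = short_exactD[OF ex]
  interpret M: right_module R M by (rule D(2))
  interpret Y: right_module R Y by (rule D(3))
  obtain \<Lambda> :: "('y \<Rightarrow> 'm) set" and i
    where i: "i \<in> rmod_hom R Y (module_power M \<Lambda>)" and inj: "inj_on i (carrier Y)"
    using cog unfolding Cog_def by blast
  let ?h = "\<lambda>l. restrict (\<lambda>m. i (g m) l) (carrier M)"
  \<comment> \<open>The zero map keeps the set of endomorphisms non-empty when \<open>\<Lambda>\<close> is empty.\<close>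
  define H where "H = insert (\<lambda>m\<in>carrier M. \<zero>\<^bsub>M\<^esub>) (?h ` \<Lambda>)"
  have "(\<lambda>m\<in>carrier M. \<zero>\<^bsub>M\<^esub>) \<in> carrier (End R M)"
    by (rule M.restrict_End, rule rmod_homI) auto
  moreover have "?h l \<in> carrier (End R M)" if "l \<in> \<Lambda>" for l
    by (rule M.restrict_End[OF rmod_hom_comp[OF D(5) power_component_hom[OF i that]]])
  ultimately have "H \<subseteq> carrier (End R M)" "H \<noteq> {}"
    by (auto simp: H_def)
  then have "direct_summand (right_annihilator M H) R M"
    using baer unfolding baer_module_def by blast
  moreover have "right_annihilator M H = a_kernel M Y g"
  proof -
    have zero: "i \<zero>\<^bsub>Y\<^esub> l = \<zero>\<^bsub>M\<^esub>" if "l \<in> \<Lambda>" for l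
      using abelian_group_hom.hom_zero[OF rmod_hom_abelian_group_hom[OF D(3,2)
            power_component_hom[OF i that]]] .
    \<comment> \<open>An element of the power is determined by its coordinates, so vanishing of all
      of them gives \<open>i (g m) = i \<zero>\<close>, and injectivity of \<open>i\<close>
      applies.\<close>
    have "g m = \<zero>\<^bsub>Y\<^esub>" if m: "m \<in> carrier M" and "\<And>l. l \<in> \<Lambda> \<Longrightarrow> i (g m) l = \<zero>\<^bsub>M\<^esub>" for m
    proof (rule inj_onD[OF inj])
      show gm: "g m \<in> carrier Y"
        by (rule rmod_homD(1)[OF D(5) m])
      show "i (g m) = i \<zero>\<^bsub>Y\<^esub>"
        using rmod_homD(1)[OF i gm] rmod_homD(1)[OF i Y.M.zero_closed] zero that(2)
        by (intro PiE_ext[of _ \<Lambda> "\<lambda>_. carrier M"]) (simp_all add: module_power_def)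
    qed simp
    then have "(\<forall>l\<in>\<Lambda>. i (g m) l = \<zero>\<^bsub>M\<^esub>) \<longleftrightarrow> g m = \<zero>\<^bsub>Y\<^esub>" if "m \<in> carrier M" for m
      using zero that by metis
    \<comment> \<open>The zero map in \<open>H\<close> imposes no condition, so adjoining it leaves
      the annihilator unchanged.\<close>
    moreover have "(\<forall>h\<in>H. h m = \<zero>\<^bsub>M\<^esub>) \<longleftrightarrow> (\<forall>l\<in>\<Lambda>. i (g m) l = \<zero>\<^bsub>M\<^esub>)"
      if "m \<in> carrier M" for m
      using that by (simp add: H_def)
    ultimately show ?thesis
      unfolding right_annihilator_def a_kernel_def' by blast
  qed
  ultimately show ?thesis
    using direct_summand_kernel_imp_splits[OF D(2,3,5,7)] by simp
qed

lemma right_annihilator_submodule: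
  assumes M: "right_module R M" and H: "H \<subseteq> carrier (End R M)"
  shows "submodule (right_annihilator M H) R M"
proof -
  interpret M: right_module R M by fact
  have hom: "f \<in> rmod_hom R M M" if "f \<in> H" for f
    using that H by (auto simp: End_simps)
  note zero = abelian_group_hom.hom_zero[OF rmod_hom_abelian_group_hom[OF M M hom]]
  show ?thesis
  proof (rule M.submoduleI)
    show "x \<oplus>\<^bsub>M\<^esub> y \<in> right_annihilator M H"
      if "x \<in> right_annihilator M H" "y \<in> right_annihilator M H" for x y
      using that rmod_homD(2)[OF hom, of _ x y] unfolding right_annihilator_def by fastforce
    show "a \<odot>\<^bsub>M\<^esub> x \<in> right_annihilator M H"
      if "a \<in> carrier R" "x \<in> right_annihilator M H" for a x
      using that rmod_homD(3)[OF hom, of _ a x] unfolding right_annihilator_def by fastforce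
  qed (auto simp: right_annihilator_def zero)
qed

text \<open>The embedding sends the coset of \<open>x\<close> to the family of all
  \<open>f x\<close> with \<open>f \<in> H\<close>. Cosets of \<open>x\<close> and \<open>y\<close>
  agree exactly when every \<open>f \<in> H\<close> kills \<open>x \<ominus> y\<close>, which yields
  both well-definedness and injectivity. The index set \<open>H\<close> does not have the type
  required by \<open>Cog\<close>, hence the appeal to \<open>Cog_any_index\<close>.\<close>

lemma quotient_by_annihilator_Cog:
  assumes M: "right_module R M" and H: "H \<subseteq> carrier (End R M)"
  shows "quotient_module M (right_annihilator M H) \<in> Cog R M"
proof -
  let ?N = "right_annihilator M H"
  let ?Q = "quotient_module M ?N"
  interpret M: right_module R M by fact
  have hom: "f \<in> rmod_hom R M M" if "f \<in> H" for f
    using that H by (auto simp: End_simps)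
  note N = right_annihilator_submodule[OF M H]
  note q = quotient_map_hom[OF M N] and qeq = quotient_map_eq_iff[OF M N]
  have eq: "?N +>\<^bsub>M\<^esub> x = ?N +>\<^bsub>M\<^esub> y \<longleftrightarrow> (\<forall>f\<in>H. f x = f y)"
    if xy: "x \<in> carrier M" "y \<in> carrier M" for x y
  proof -
    have "f (x \<ominus>\<^bsub>M\<^esub> y) = \<zero>\<^bsub>M\<^esub> \<longleftrightarrow> f x = f y" if "f \<in> H" for f
    proof -
      interpret f: abelian_group_hom M M f
        by (rule rmod_hom_abelian_group_hom[OF M M hom[OF that]])
      have fxy: "f x \<in> carrier M" "f y \<in> carrier M"
        using xy by auto
      have "f (x \<ominus>\<^bsub>M\<^esub> y) = f x \<ominus>\<^bsub>M\<^esub> f y"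
        using xy by (simp add: M.M.minus_eq)
      also have "f x \<ominus>\<^bsub>M\<^esub> f y = \<zero>\<^bsub>M\<^esub> \<longleftrightarrow> f x = f y"
        using fxy by (metis M.M.minus_eq M.M.r_neg M.M.minus_equality M.M.minus_minus M.M.a_inv_closed)
      finally show ?thesis .
    qed
    then show ?thesis
      using qeq[OF xy] xy by (auto simp: right_annihilator_def)
  qed
  \<comment> \<open>\<open>r\<close> chooses a representative of each coset; \<open>fr\<close> below
    shows that the values of \<open>f \<in> H\<close> do not depend on the choice.\<close>
  define r where "r = inv_into (carrier M) (\<lambda>x. ?N +>\<^bsub>M\<^esub> x)"
  have r: "r C \<in> carrier M" "?N +>\<^bsub>M\<^esub> r C = C" if "C \<in> carrier ?Q" for C
    using that unfolding quotient_map_surj[OF M N, symmetric] r_def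
    by (rule inv_into_into, rule f_inv_into_f)
  have fr: "f (r (?N +>\<^bsub>M\<^esub> x)) = f x" if "f \<in> H" "x \<in> carrier M" for f x
    using eq[of "r (?N +>\<^bsub>M\<^esub> x)" x] r[OF rmod_homD(1)[OF q that(2)]] that by blast
  define i where "i = (\<lambda>C. \<lambda>f\<in>H. f (r C))"
  have i: "i (?N +>\<^bsub>M\<^esub> x) = (\<lambda>f\<in>H. f x)" if "x \<in> carrier M" for x
    unfolding i_def using fr that by (intro restrict_ext) blast
  show ?thesis
  proof (rule Cog_any_index[OF right_module_quotient[OF M N] M])
    show "i \<in> rmod_hom R ?Q (module_power M H)"
    proof (rule rmod_homI)
      fix C assume C: "C \<in> carrier ?Q"
      show "i C \<in> carrier (module_power M H)"
        using r(1)[OF C] rmod_homD(1)[OF hom] by (auto simp: i_def module_power_def)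
      {
        fix D assume D: "D \<in> carrier ?Q"
        have "C \<oplus>\<^bsub>?Q\<^esub> D = ?N +>\<^bsub>M\<^esub> (r C \<oplus>\<^bsub>M\<^esub> r D)"
          using rmod_homD(2)[OF q r(1)[OF C] r(1)[OF D]] r(2)[OF C] r(2)[OF D] by simp
        then have "i (C \<oplus>\<^bsub>?Q\<^esub> D) = (\<lambda>f\<in>H. f (r C \<oplus>\<^bsub>M\<^esub> r D))"
          using i r(1)[OF C] r(1)[OF D] by simp
        then show "i (C \<oplus>\<^bsub>?Q\<^esub> D) = i C \<oplus>\<^bsub>module_power M H\<^esub> i D"
          using rmod_homD(2)[OF hom r(1)[OF C] r(1)[OF D]]
          by (auto simp: i_def module_power_def intro!: restrict_ext)
      next
        fix a assume a: "a \<in> carrier R"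
        have "a \<odot>\<^bsub>?Q\<^esub> C = ?N +>\<^bsub>M\<^esub> (a \<odot>\<^bsub>M\<^esub> r C)"
          using rmod_homD(3)[OF q a r(1)[OF C]] r(2)[OF C] by simp
        then have "i (a \<odot>\<^bsub>?Q\<^esub> C) = (\<lambda>f\<in>H. f (a \<odot>\<^bsub>M\<^esub> r C))"
          using i a r(1)[OF C] by simp
        then show "i (a \<odot>\<^bsub>?Q\<^esub> C) = a \<odot>\<^bsub>module_power M H\<^esub> i C"
          using rmod_homD(3)[OF hom a r(1)[OF C]]
          by (auto simp: i_def module_power_def intro!: restrict_ext)
      }
    qed
    show "inj_on i (carrier ?Q)"
    proof (rule inj_onI)
      fix C D assume C: "C \<in> carrier ?Q" and D: "D \<in> carrier ?Q" and "i C = i D"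
      then have "\<forall>f\<in>H. f (r C) = f (r D)"
        unfolding i_def by (metis restrict_apply')
      then have "?N +>\<^bsub>M\<^esub> r C = ?N +>\<^bsub>M\<^esub> r D"
        using eq r(1)[OF C] r(1)[OF D] by simp
      then show "C = D"
        using r(2)[OF C] r(2)[OF D] by simp
    qed
  qed
qed

text \<open>Only the sequences formed by a submodule of \<open>M\<close> and its quotient are
  needed, so splitting is assumed just for the types of those two modules.\<close>

lemma baer_if_quotients_split:
  fixes R :: "('r, 'q) ring_scheme" and M :: "('r, 'm, 'z) module_scheme"
  assumes M: "right_module R M"
    and split: "\<And>(X :: ('r, 'm) module) (Y :: ('r, 'm set) module) f g.
      \<lbrakk>short_exact R X M Y f g; Y \<in> Cog R M\<rbrakk> \<Longrightarrow> splits R M Y g"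
  shows "baer_module R M"
  unfolding baer_module_def
proof (intro allI impI)
  fix H assume "H \<noteq> {} \<and> H \<subseteq> carrier (End R M)"
  then have H: "H \<subseteq> carrier (End R M)"
    by blast
  note N = right_annihilator_submodule[OF M H]
  show "direct_summand (right_annihilator M H) R M"
    by (rule quotient_splits_imp_retraction[OF M N
          split[OF short_exact_quotient[OF M N] quotient_by_annihilator_Cog[OF M H]]])
      (rule retraction_imp_direct_summand[OF M N])
qed

section \<open>Dual Baer modules and kernels generated by \<open>M\<close>\<close>

lemma dual_baer_imp_splits:
  fixes M :: "('r, 'm, 'z) module_scheme" and X :: "('r, 'x, 'u) module_scheme"
  assumes dual: "dual_baer_module R M" and ex: "short_exact R X M Y f g" and gen: "X \<in> Gen R M"
  shows "splits R M Y g"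
proof -
  note D = short_exactD[OF ex]
  interpret M: right_module R M by (rule D(2))
  let ?N = "a_kernel M Y g"
  note N = submodule_kernel[OF D(2,3,5)]
  obtain e where e: "e \<in> carrier (End R M)" "e \<otimes>\<^bsub>End R M\<^esub> e = e"
    and eS: "Hom_into R M ?N = e <#\<^bsub>End R M\<^esub> carrier (End R M)"
    using dual N unfolding dual_baer_module_def by blast
  have ehom: "e \<in> rmod_hom R M M"
    using e(1) by (simp add: End_simps)
  \<comment> \<open>Idempotence exhibits \<open>e\<close> as a member of \<open>e S\<close>.\<close>
  have "e \<in> Hom_into R M ?N"
    unfolding eS l_coset_def using e by force
  then have into: "e ` carrier M \<subseteq> ?N"
    by (simp add: Hom_into_def)
  have ee: "e (e x) = e x" if "x \<in> carrier M" for x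
    using fun_cong[OF e(2), of x] that by (simp add: End_simps compose_def)
  note E = submoduleD[OF submodule_image[OF D(2,2) ehom]]
  \<comment> \<open>Every endomorphism into the kernel factors as \<open>e\<close> after some
    \<open>k\<close>, so its values lie in the image of \<open>e\<close>.\<close>
  have image: "h m \<in> e ` carrier M" if h: "h \<in> Hom_into R M ?N" and m: "m \<in> carrier M" for h m
  proof -
    obtain k where "k \<in> carrier (End R M)" "h = e \<otimes>\<^bsub>End R M\<^esub> k"
      using h unfolding eS l_coset_def by blast
    then show ?thesis
      using m rmod_homD(1)[of k R M M] by (simp add: End_simps compose_def)
  qed
  obtain \<Lambda> :: "('m \<Rightarrow> 'x) set" and p
    where p: "p \<in> rmod_hom R (module_copower M \<Lambda>) X"
      and surj: "p ` carrier (module_copower M \<Lambda>) = carrier X"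
    using gen unfolding Gen_def by blast
  let ?C = "module_copower M \<Lambda>"
  note fp = rmod_hom_comp[OF p D(4)]
  have fpu: "f (p u) \<in> e ` carrier M" if "u \<in> carrier ?C" for u
    using that
  proof (induction rule: M.copower_induct)
    case zero
    have "f (p \<zero>\<^bsub>?C\<^esub>) = \<zero>\<^bsub>M\<^esub>"
      using abelian_group_hom.hom_zero[OF rmod_hom_abelian_group_hom[OF M.right_module_copower D(2) fp]] .
    then show ?case
      using E(2) by simp
  next
    case (add l m v)
    let ?s = "copower_single M \<Lambda> l"
    \<comment> \<open>Restricted to one summand, the composite of \<open>f\<close> and
      \<open>p\<close> becomes an endomorphism of \<open>M\<close> into the kernel, to which
      \<open>image\<close> applies.\<close>
    let ?h = "restrict (\<lambda>m. f (p (?s m))) (carrier M)"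
    have s: "?s m \<in> carrier ?C" if "m \<in> carrier M" for m
      by (rule rmod_homD(1)[OF M.copower_single_hom that])
    have "f (p (?s m)) \<in> ?N" if "m \<in> carrier M" for m
      unfolding D(6)[symmetric] by (rule imageI[OF rmod_homD(1)[OF p s[OF that]]])
    then have "?h \<in> Hom_into R M ?N"
      using M.restrict_End[OF rmod_hom_comp[OF M.copower_single_hom fp]]
      by (auto simp: Hom_into_def)
    from image[OF this add.hyps(2)] have "f (p (?s m)) \<in> e ` carrier M"
      using add.hyps(2) by simp
    then show ?case
      unfolding rmod_homD(2)[OF fp s[OF add.hyps(2)] add.hyps(3)] by (rule E(3)[OF _ add.IH])
  qed
  \<comment> \<open>Surjectivity of \<open>p\<close> and exactness put the whole kernel inside the
    image of \<open>e\<close>, which the idempotent \<open>e\<close> fixes pointwise.\<close>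
  have ident: "e x = x" if x: "x \<in> ?N" for x
  proof -
    have "x \<in> f ` p ` carrier ?C"
      unfolding surj D(6) by (rule x)
    then have "x \<in> e ` carrier M"
      using fpu by blast
    then show ?thesis
      using ee by auto
  qed
  show ?thesis
    by (rule direct_summand_kernel_imp_splits[OF D(2,3,5,7)
          retraction_imp_direct_summand[OF D(2) N ehom into ident]])
qed

text \<open>The submodule \<open>T\<close> is the trace of \<open>M\<close> in \<open>N\<close>.\<close>

lemma submodule_subset_Gen:
  assumes M: "right_module R M" and N: "submodule N R M"
  obtains T where "submodule T R M" "T \<subseteq> N" "submodule_module M T \<in> Gen R M"
    "\<And>h. h \<in> Hom_into R M N \<Longrightarrow> h ` carrier M \<subseteq> T"
proof -
  interpret M: right_module R M by fact
  \<comment> \<open>One copy of \<open>M\<close> is taken for each endomorphism into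
    \<open>N\<close>; the image of the induced map is the sum of all their images.\<close>
  let ?\<Lambda> = "Hom_into R M N"
  let ?C = "module_copower M ?\<Lambda>"
  let ?p = "copower_sum M M ?\<Lambda>"
  have \<Lambda>: "?\<Lambda> \<subseteq> rmod_hom R M M"
    by (auto simp: Hom_into_def End_simps)
  note p = copower_sum_hom[OF M M \<Lambda>] and single = copower_sum_single[OF M M \<Lambda>]
  define T where "T = ?p ` carrier ?C"
  have T: "submodule T R M"
    unfolding T_def by (rule submodule_image[OF M.right_module_copower M p])
  show thesis
  proof (rule that[OF T])
    have "?p u \<in> N" if "u \<in> carrier ?C" for u
      using that
    proof (induction rule: M.copower_induct)
      case zero
      show ?case
        using abelian_group_hom.hom_zero[OF rmod_hom_abelian_group_hom[OF M.right_module_copower M p]]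
          submoduleD(2)[OF N] by simp
    next
      case (add h m v)
      have "h m \<in> N"
        using add.hyps by (auto simp: Hom_into_def)
      then show ?case
        unfolding rmod_homD(2)[OF p rmod_homD(1)[OF M.copower_single_hom add.hyps(2)] add.hyps(3)]
          single[OF add.hyps(1,2)]
        by (rule submoduleD(3)[OF N _ add.IH])
    qed
    then show "T \<subseteq> N"
      by (auto simp: T_def)
    have "?p \<in> rmod_hom R ?C (submodule_module M T)"
      using rmod_homD(2,3)[OF p] by (intro rmod_homI) (auto simp: T_def)
    then show "submodule_module M T \<in> Gen R M"
      by (rule Gen_any_index[OF right_module_submodule[OF M T] M]) (simp add: T_def)
    show "h ` carrier M \<subseteq> T" if "h \<in> ?\<Lambda>" for h
    proof
      fix x assume "x \<in> h ` carrier M"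
      then obtain m where m: "m \<in> carrier M" "x = h m"
        by blast
      then show "x \<in> T"
        unfolding T_def m(2) single[OF that m(1), symmetric]
        by (intro imageI rmod_homD(1)[OF M.copower_single_hom])
    qed
  qed
qed

text \<open>\<open>N\<close> itself need not be generated by \<open>M\<close>, so the hypothesis is
  applied to its trace \<open>T\<close>. This suffices because every endomorphism into
  \<open>N\<close> already maps into \<open>T\<close>.\<close>

lemma dual_baer_if_quotients_split:
  fixes R :: "('r, 'q) ring_scheme" and M :: "('r, 'm, 'z) module_scheme"
  assumes M: "right_module R M"
    and split: "\<And>(X :: ('r, 'm) module) (Y :: ('r, 'm set) module) f g.
      \<lbrakk>short_exact R X M Y f g; X \<in> Gen R M\<rbrakk> \<Longrightarrow> splits R M Y g"
  shows "dual_baer_module R M"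
  unfolding dual_baer_module_def
proof (intro allI impI)
  fix N assume N: "submodule N R M"
  interpret M: right_module R M by fact
  obtain T where T: "submodule T R M" "T \<subseteq> N" and gen: "submodule_module M T \<in> Gen R M"
    and TN: "\<And>h. h \<in> Hom_into R M N \<Longrightarrow> h ` carrier M \<subseteq> T"
    using submodule_subset_Gen[OF M N] by blast
  obtain e where e: "e \<in> rmod_hom R M M" "e ` carrier M \<subseteq> T" "\<And>x. x \<in> T \<Longrightarrow> e x = x"
    using quotient_splits_imp_retraction[OF M T(1) split[OF short_exact_quotient[OF M T(1)] gen]]
    by blast
  define d where "d = restrict e (carrier M)"
  have d: "d \<in> carrier (End R M)"
    unfolding d_def by (rule M.restrict_End[OF e(1)])
  have dval: "d x = e x" if "x \<in> carrier M" for x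
    using that by (simp add: d_def)
  have dT: "d x \<in> T" if "x \<in> carrier M" for x
    using that e(2) dval by auto
  have did: "d x = x" if "x \<in> T" for x
    using that e(3) dval submoduleD(1)[OF T(1)] by auto
  \<comment> \<open>As \<open>d\<close> fixes \<open>T\<close> pointwise, it is a left identity for
    endomorphisms into \<open>T\<close>. Applied to \<open>d\<close> this gives idempotence; applied
    to members of \<open>Hom_into R M N\<close> it places them in \<open>d S\<close>.\<close>
  have comp: "d \<otimes>\<^bsub>End R M\<^esub> h = h" if h: "h \<in> carrier (End R M)" "h ` carrier M \<subseteq> T" for h
    unfolding End_simps(2)
  proof (rule extensionalityI[of _ "carrier M"])
    show "h \<in> extensional (carrier M)"
      using h(1) by (simp add: End_simps)
    show "compose (carrier M) d h x = h x" if "x \<in> carrier M" for x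
      using that h(2) did by (auto simp: compose_def)
  qed simp
  have "d \<otimes>\<^bsub>End R M\<^esub> d = d"
    using dT by (intro comp d) auto
  moreover have "Hom_into R M N = d <#\<^bsub>End R M\<^esub> carrier (End R M)"
  proof
    show "Hom_into R M N \<subseteq> d <#\<^bsub>End R M\<^esub> carrier (End R M)"
    proof
      fix h assume h: "h \<in> Hom_into R M N"
      then have hE: "h \<in> carrier (End R M)"
        by (simp add: Hom_into_def)
      then show "h \<in> d <#\<^bsub>End R M\<^esub> carrier (End R M)"
        unfolding l_coset_def using comp[OF hE TN[OF h]] by force
    qed
    show "d <#\<^bsub>End R M\<^esub> carrier (End R M) \<subseteq> Hom_into R M N"
    proof
      fix h assume "h \<in> d <#\<^bsub>End R M\<^esub> carrier (End R M)"
      then obtain k where k: "k \<in> carrier (End R M)" and h: "h = compose (carrier M) d k"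
        unfolding l_coset_def End_simps(2) by blast
      have khom: "k \<in> rmod_hom R M M" and dhom: "d \<in> rmod_hom R M M"
        using k d by (simp_all add: End_simps)
      have "h \<in> carrier (End R M)"
        unfolding h compose_def by (rule M.restrict_End[OF rmod_hom_comp[OF khom dhom]])
      moreover have "h ` carrier M \<subseteq> N"
        using T(2) dT rmod_homD(1)[OF khom] by (auto simp: h compose_def)
      ultimately show "h \<in> Hom_into R M N"
        by (simp add: Hom_into_def)
    qed
  qed
  ultimately show "\<exists>e\<in>carrier (End R M). e \<otimes>\<^bsub>End R M\<^esub> e = e \<and>
      Hom_into R M N = e <#\<^bsub>End R M\<^esub> carrier (End R M)"
    using d by blast
qed

text \<open>Bound variables have fixed types, so each equivalence is stated for the types of
  submodules and quotients of \<open>M\<close>, which suffice for the converse. The last two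
  conjuncts give the forward directions for \<open>X\<close> and \<open>Y\<close> over arbitrary
  types.\<close>

theorem theorem2p4:
  fixes R :: "('r, 'q) ring_scheme" and M :: "('r, 'm, 'z) module_scheme"
  assumes "right_module R M"
  shows
    "(baer_module R M \<longleftrightarrow>
        (\<forall>(X :: ('r, 'm) module) (Y :: ('r, 'm set) module) f g.
           short_exact R X M Y f g \<and> Y \<in> Cog R M \<longrightarrow> splits R M Y g)) \<and>
     (dual_baer_module R M \<longleftrightarrow>
        (\<forall>(X :: ('r, 'm) module) (Y :: ('r, 'm set) module) f g.
           short_exact R X M Y f g \<and> X \<in> Gen R M \<longrightarrow> splits R M Y g)) \<and>
     (baer_module R M \<longrightarrow>
        (\<forall>(X :: ('r, 'x, 'u) module_scheme) (Y :: ('r, 'y, 'w) module_scheme) f g.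
           short_exact R X M Y f g \<and> Y \<in> Cog R M \<longrightarrow> splits R M Y g)) \<and>
     (dual_baer_module R M \<longrightarrow>
        (\<forall>(X :: ('r, 'x, 'u) module_scheme) (Y :: ('r, 'y, 'w) module_scheme) f g.
           short_exact R X M Y f g \<and> X \<in> Gen R M \<longrightarrow> splits R M Y g))"
proof (intro conjI iffI allI impI; (elim conjE)?)
  show "baer_module R M"
    if "\<forall>(X :: ('r, 'm) module) (Y :: ('r, 'm set) module) f g.
      short_exact R X M Y f g \<and> Y \<in> Cog R M \<longrightarrow> splits R M Y g"
    by (rule baer_if_quotients_split[OF assms that[rule_format, OF conjI]])
  show "dual_baer_module R M"
    if "\<forall>(X :: ('r, 'm) module) (Y :: ('r, 'm set) module) f g.
      short_exact R X M Y f g \<and> X \<in> Gen R M \<longrightarrow> splits R M Y g"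
    by (rule dual_baer_if_quotients_split[OF assms that[rule_format, OF conjI]])
\<comment> \<open>The four remaining goals are the forward directions, each once at the special
  types and once at arbitrary ones.\<close>
qed (fact baer_imp_splits dual_baer_imp_splits)+

end
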